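(* Let $(\mathfrak{A},\mathfrak{b})$ be a Blanchfield module with a fixed decomposition $\mathfrak{A}=\bigoplus_{i=1}^q\mathfrak{A}_i$, $\mathfrak{A}_i=\frac{\mathbb{Q}[t^{\pm1}]}{(\delta_i)}\eta_i$, as described in the context, and let $\underline{i}=(i_1,i_2,i_3)\in\{1,\dots,q\}^3$. The rational vector space $\mathcal{H}(\underline{i})$ is non trivial if and only if there are complex roots $z_1,z_2,z_3$ of $\delta_{i_1},\delta_{i_2},\delta_{i_3}$ respectively, which satisfy: \begin{itemize} \item $z_1z_2z_3=1$, \item for $1\leq j\leq3$, the multiplicity $m_{i_j}$ is at least the number of indices $l\in\{1,2,3\}$ such that $i_l=i_j$ and $z_l=z_j$. \end{itemize}
   Context: Blanchfield modules. A $\mathbb{Q}$SK-pair $(M,K)$ consists of a rational homology 3-sphere $M$ (an oriented compact 3-manifold with the same rational homology as $S^3$) and a knot $K\subset M$ which is trivial in $H_1(M;\mathbb{Z})$. Let $\tilde X$ be the infinite cyclic covering of the exterior $X$ of $K$, associated with the kernel of $\pi_1(X)\to H_1(X;\mathbb{Z})/\mathrm{torsion}\cong\mathbb{Z}$, with generating deck transformation $\tau$. Its Alexander module is $H_1(\tilde X;\mathbb{Q})$, a finitely generated torsion $\mathbb{Q}[t^{\pm1}]$-module with $t$ acting as $\tau_*$. Its Blanchfield form is defined by $\mathfrak{b}([\mu_1],[\mu_2])=\frac1{P(t)}\sum_{k\in\mathbb{Z}}\langle S,\tau^k(\mu_2)\rangle t^k\bmod\mathbb{Q}[t^{\pm1}]$,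 for knots $\mu_1,\mu_2$ in $\tilde X$ with $\mu_1$ disjoint from all $\tau^k(\mu_2)$, $P\neq0$, $\partial S=P(\tau)\mu_1$; it is hermitian, non degenerate, with values in $\mathbb{Q}(t)/\mathbb{Q}[t^{\pm1}]$. A Blanchfield module $(\mathfrak{A},\mathfrak{b})$ is a module with a pairing isomorphic to the Alexander module of some $\mathbb{Q}$SK-pair with its Blanchfield form. Decomposition. Fix a family $(\eta_i)_{1\leq i\leq q}$ in $\mathfrak{A}$, an involution $d$ of that family, and polynomials $a_i,\delta_i\in\mathbb{Q}[t^{\pm1}]$ such that: $\mathfrak{A}=\bigoplus_{i=1}^q\mathfrak{A}_i$ with $\mathfrak{A}_i=\frac{\mathbb{Q}[t^{\pm1}]}{(\delta_i)}\eta_i$; $\mathfrak{b}(\eta_i,d(\eta_j))=0$ if $i\neq j$; each $\delta_i$ is a power of a prime polynomial; $\mathfrak{b}(\eta_i,d(\eta_i))=\frac{a_i}{\delta_i}$ with $a_i$ prime to $\delta_i$. Write $m_i$ for the exponent when $\delta_i$ is written as a power of a prime polynomial (so $m_i$ is the multiplicity of any complex root of $\delta_i$); it is required that $m_i\geq m_{i+1}$, and that $\delta_i\in\mathbb{Q}[t]$, $\delta_i(0)\neq0$, $\delta_i(1)=1$. Such a decomposition always exists. Spaces. $\mathcal{H}$ is the quotient of the $\mathbb{Q}$-vector space $\Lambda^3_{\mathbb{Q}}\mathfrak{A}$ by the $\mathbb{Q}$-subspace generated by all $\beta_1\wedge\beta_2\wedge\beta_3-t\beta_1\wedge t\beta_2\wedge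 t\beta_3$. For $\underline{i}=(i_1,i_2,i_3)$, $\mathcal{H}(\underline{i})$ is the rational vector subspace of $\mathcal{H}$ generated by the $t^{k_1}\eta_{i_1}\wedge t^{k_2}\eta_{i_2}\wedge t^{k_3}\eta_{i_3}$ for all integers $k_1,k_2,k_3$. *)

theory Defs
  imports
    "HOL-Homology.Homology_Groups"
    "HOL-Analysis.Analysis"
    "HOL-Computational_Algebra.Polynomial"
    "HOL-Computational_Algebra.Fraction_Field"
    "HOL-Library.Poly_Mapping"
    "HOL-Library.Groups_Big_Fun"
begin

section \<open>The ring $Q[t,t^{-1}]$ and the module $Q(t)/Q[t,t^{-1}]$\<close>

text \<open>The group ring of the integers: \<open>Poly_Mapping.single k c\<close> is \<open>c t^k\<close>, and multiplication of
  finitely supported functions is convolution.\<close>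

type_synonym laurent = "int \<Rightarrow>\<^sub>0 rat"

definition laurent_of_poly :: "rat poly \<Rightarrow> laurent" where
  "laurent_of_poly p = (\<Sum>n\<le>degree p. Poly_Mapping.single (int n) (coeff p n))"

definition laurent_conj :: "laurent \<Rightarrow> laurent" where
  "laurent_conj P = (\<Sum>k\<in>Poly_Mapping.keys P. Poly_Mapping.single (- k) (Poly_Mapping.lookup P k))"

definition laurent_cong :: "laurent fract \<Rightarrow> laurent fract \<Rightarrow> bool" where
  "laurent_cong x y \<longleftrightarrow> (\<exists>P. x - y = Fract P 1)"

lemma equivp_laurent_cong: "equivp laurent_cong"
proof (rule equivpI)
  show "reflp laurent_cong"
    by (auto simp: reflp_def laurent_cong_def Zero_fract_def)
  show "symp laurent_cong"
  proof (rule sympI)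
    fix x y assume "laurent_cong x y"
    then obtain P where "x - y = Fract P 1" by (auto simp: laurent_cong_def)
    then have "y - x = Fract (- P) 1"
      by (metis minus_diff_eq minus_fract)
    then show "laurent_cong y x" by (auto simp: laurent_cong_def)
  qed
  show "transp laurent_cong"
  proof (rule transpI)
    fix x y z assume "laurent_cong x y" "laurent_cong y z"
    then obtain P R where "x - y = Fract P 1" "y - z = Fract R 1" by (auto simp: laurent_cong_def)
    then have "x - z = Fract P 1 + Fract R 1" by (simp add: algebra_simps)
    then have "x - z = Fract (P + R) 1" by simp
    then show "laurent_cong x z" unfolding laurent_cong_def by blast
  qed
qed

quotient_type fract_mod_laurent = "laurent fract" / laurent_cong
  by (rule equivp_laurent_cong)

definition fml_class :: "laurent fract \<Rightarrow> fract_mod_laurent" where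
  "fml_class x = abs_fract_mod_laurent x"

definition fml_zero :: fract_mod_laurent where
  "fml_zero = fml_class 0"

definition fml_add :: "fract_mod_laurent \<Rightarrow> fract_mod_laurent \<Rightarrow> fract_mod_laurent" where
  "fml_add u v = fml_class (rep_fract_mod_laurent u + rep_fract_mod_laurent v)"

definition fml_scale :: "laurent \<Rightarrow> fract_mod_laurent \<Rightarrow> fract_mod_laurent" where
  "fml_scale P u = fml_class (Fract P 1 * rep_fract_mod_laurent u)"

lemma fml_class_eq_iff: "fml_class x = fml_class y \<longleftrightarrow> (\<exists>P. x - y = Fract P 1)"
  by (simp add: fml_class_def fract_mod_laurent.abs_eq_iff laurent_cong_def)

lemma laurent_cong_rep: "laurent_cong (rep_fract_mod_laurent (fml_class x)) x"
  unfolding fml_class_def by (rule Quotient3_rep_abs[OF Quotient3_fract_mod_laurent])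
    (rule equivp_reflp[OF equivp_laurent_cong])

lemma fml_add_class: "fml_add (fml_class x) (fml_class y) = fml_class (x + y)"
proof -
  obtain P R where "rep_fract_mod_laurent (fml_class x) - x = Fract P 1"
    "rep_fract_mod_laurent (fml_class y) - y = Fract R 1"
    using laurent_cong_rep unfolding laurent_cong_def by meson
  then have "(rep_fract_mod_laurent (fml_class x) + rep_fract_mod_laurent (fml_class y)) - (x + y) =
      Fract P 1 + Fract R 1"
    by (simp only: add_diff_add)
  then have "(rep_fract_mod_laurent (fml_class x) + rep_fract_mod_laurent (fml_class y)) - (x + y) =
      Fract (P + R) 1"
    by simp
  then show ?thesis unfolding fml_add_def fml_class_eq_iff by blast
qed

lemma fml_scale_class: "fml_scale P (fml_class x) = fml_class (Fract P 1 * x)"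
proof -
  obtain R where "rep_fract_mod_laurent (fml_class x) - x = Fract R 1"
    using laurent_cong_rep unfolding laurent_cong_def by meson
  then have "Fract P 1 * rep_fract_mod_laurent (fml_class x) - Fract P 1 * x = Fract P 1 * Fract R 1"
    by (simp only: right_diff_distrib[symmetric])
  then have "Fract P 1 * rep_fract_mod_laurent (fml_class x) - Fract P 1 * x = Fract (P * R) 1"
    by simp
  then show ?thesis unfolding fml_scale_def fml_class_eq_iff by blast
qed


section \<open>Rational vector spaces of finitely supported functions, and quotients\<close>

definition rat_scale :: "rat \<Rightarrow> ('k \<Rightarrow>\<^sub>0 rat) \<Rightarrow> ('k \<Rightarrow>\<^sub>0 rat)" where
  "rat_scale q = Poly_Mapping.map (\<lambda>x. q * x)"

lemma lookup_rat_scale [simp]: "Poly_Mapping.lookup (rat_scale q c) k = q * Poly_Mapping.lookup c k"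
  by (simp add: rat_scale_def map.rep_eq when_def)

lemma vector_space_rat_scale: "vector_space (rat_scale :: rat \<Rightarrow> ('k \<Rightarrow>\<^sub>0 rat) \<Rightarrow> _)"
  by unfold_locales (auto intro!: poly_mapping_eqI simp: lookup_add algebra_simps)

definition additive_group :: "'v::ab_group_add set \<Rightarrow> 'v monoid" where
  "additive_group A = \<lparr>carrier = A, monoid.mult = (+), one = 0\<rparr>"


section \<open>Singular homology with rational coefficients\<close>

type_synonym 'x rat_chain = "((nat \<Rightarrow> real) \<Rightarrow> 'x) \<Rightarrow>\<^sub>0 rat"

definition rat_chains :: "nat \<Rightarrow> 'x topology \<Rightarrow> 'x rat_chain set" where
  "rat_chains n X = {c. Poly_Mapping.keys c \<subseteq> singular_simplex_set n X}"

definition rat_boundary :: "nat \<Rightarrow> 'x rat_chain \<Rightarrow> 'x rat_chain" where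
  "rat_boundary n c =
     (\<Sum>\<sigma>\<in>Poly_Mapping.keys c. rat_scale (Poly_Mapping.lookup c \<sigma>) (Poly_Mapping.map rat_of_int (chain_boundary n (frag_of \<sigma>))))"

definition rat_chain_map :: "nat \<Rightarrow> ('x \<Rightarrow> 'y) \<Rightarrow> 'x rat_chain \<Rightarrow> 'y rat_chain" where
  "rat_chain_map n g c = (\<Sum>\<sigma>\<in>Poly_Mapping.keys c. Poly_Mapping.single (simplex_map n g \<sigma>) (Poly_Mapping.lookup c \<sigma>))"

definition rat_cycle_group :: "nat \<Rightarrow> 'x topology \<Rightarrow> 'x rat_chain monoid" where
  "rat_cycle_group n X = additive_group {c \<in> rat_chains n X. rat_boundary n c = 0}"

definition rat_boundaries :: "nat \<Rightarrow> 'x topology \<Rightarrow> 'x rat_chain set" where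
  "rat_boundaries n X = rat_boundary (Suc n) ` rat_chains (Suc n) X"

definition rat_homology_group :: "nat \<Rightarrow> 'x topology \<Rightarrow> 'x rat_chain set monoid" where
  "rat_homology_group n X = rat_cycle_group n X Mod rat_boundaries n X"

definition rat_homology_class :: "nat \<Rightarrow> 'x topology \<Rightarrow> 'x rat_chain \<Rightarrow> 'x rat_chain set" where
  "rat_homology_class n X c = rat_boundaries n X #>\<^bsub>rat_cycle_group n X\<^esub> c"


section \<open>Rational homology 3-spheres and knots\<close>

text \<open>An additive isomorphism between rational vector spaces is automatically linear, so the
  group isomorphism below is an isomorphism of rational homology. Since \<open>H\<^sub>3(M;Q)\<close> is then nonzero,
  the boundary of the manifold is empty, so that charts onto the whole of 3-space suffice.\<close>

definition rational_homology_3_sphere :: "'x::t2_space set \<Rightarrow> bool" where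
  "rational_homology_3_sphere M \<longleftrightarrow>
     compact M \<and>
     (\<forall>x\<in>M. \<exists>U. openin (top_of_set M) U \<and> x \<in> U \<and> U homeomorphic (UNIV :: (real^3) set)) \<and>
     (\<forall>n. rat_homology_group n (top_of_set M) \<cong> rat_homology_group n (nsphere 3))"

text \<open>An orientation is given by a cycle that generates every local homology group
  \<open>H\<^sub>3(M, M - x; Z)\<close>.\<close>

definition fundamental_cycle :: "'x::t2_space set \<Rightarrow> 'x chain \<Rightarrow> bool" where
  "fundamental_cycle M Z \<longleftrightarrow>
     singular_relcycle 3 (top_of_set M) {} Z \<and>
     (\<forall>x\<in>M. \<forall>c. singular_relcycle 3 (top_of_set M) (M - {x}) c \<longrightarrow>
        (\<exists>n. homologous_rel 3 (top_of_set M) (M - {x}) c (frag_cmul n Z)))"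

text \<open>Knots are tame. They are described by parametrized open tubular neighbourhoods
  \<open>S\<^sup>1 \<times> C \<rightarrow> Y\<close>, the knot itself being the image of \<open>S\<^sup>1 \<times> 0\<close>, oriented by \<open>S\<^sup>1\<close>;
  as its image is open, such a tube lies in the interior of the 3-manifold \<open>Y\<close>.\<close>

definition knot_tube :: "'x::topological_space set \<Rightarrow> (complex \<times> complex \<Rightarrow> 'x) \<Rightarrow> bool" where
  "knot_tube Y f \<longleftrightarrow>
     openin (top_of_set Y) (f ` (sphere 0 1 \<times> UNIV)) \<and>
     (\<exists>g. homeomorphism (sphere 0 1 \<times> UNIV) (f ` (sphere 0 1 \<times> UNIV)) f g)"

definition knot_of :: "(complex \<times> complex \<Rightarrow> 'x) \<Rightarrow> 'x set" where
  "knot_of f = f ` (sphere 0 1 \<times> {0})"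

definition path_simplex :: "(real \<Rightarrow> 'x) \<Rightarrow> (nat \<Rightarrow> real) \<Rightarrow> 'x" where
  "path_simplex h = restrict (\<lambda>x. h (x 1)) (standard_simplex 1)"

text \<open>The singular 1-simplex (and cycle) running once along the knot.\<close>

definition knot_simplex :: "(complex \<times> complex \<Rightarrow> 'x) \<Rightarrow> (nat \<Rightarrow> real) \<Rightarrow> 'x" where
  "knot_simplex f = path_simplex (\<lambda>s. f (cis (2 * pi * s), 0))"

definition QSK_pair :: "'x::t2_space set \<Rightarrow> 'x chain \<Rightarrow> 'x set \<Rightarrow> bool" where
  "QSK_pair M Z K \<longleftrightarrow>
     rational_homology_3_sphere M \<and> fundamental_cycle M Z \<and>
     (\<exists>f. knot_tube M f \<and> K = knot_of f \<and>
          singular_relboundary 1 (top_of_set M) {} (frag_of (knot_simplex f)))"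

text \<open>The exterior is the complement of the interior of a closed tubular neighbourhood that is
  contained in an open one, so that its boundary torus is bicollared.\<close>

definition knot_exterior :: "'x::t2_space set \<Rightarrow> 'x set \<Rightarrow> 'x set \<Rightarrow> bool" where
  "knot_exterior M K X \<longleftrightarrow>
     (\<exists>f. knot_tube M f \<and> K = knot_of f \<and> X = M - f ` (sphere 0 1 \<times> ball 0 1))"


section \<open>The infinite cyclic covering and the Alexander module\<close>

definition deck_transformation :: "'y::topological_space set \<Rightarrow> ('y \<Rightarrow> 'x) \<Rightarrow> ('y \<Rightarrow> 'y) \<Rightarrow> bool" where
  "deck_transformation Y p \<sigma> \<longleftrightarrow> (\<exists>\<sigma>'. homeomorphism Y Y \<sigma> \<sigma>') \<and> (\<forall>y\<in>Y. p (\<sigma> y) = p y)"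

definition deck_power :: "'y set \<Rightarrow> ('y \<Rightarrow> 'y) \<Rightarrow> int \<Rightarrow> 'y \<Rightarrow> 'y" where
  "deck_power Y \<tau> k = (if 0 \<le> k then \<tau> ^^ nat k else inv_into Y \<tau> ^^ nat (- k))"

text \<open>The covering is connected, and a loop of \<open>X\<close> lifts to a loop if and only if its homology
  class in \<open>H\<^sub>1(X;Z)\<close> is torsion, i.e. the covering is associated with the kernel of
  \<open>\<pi>\<^sub>1(X) \<rightarrow> H\<^sub>1(X;Z)/torsion\<close>; \<open>\<tau>\<close> generates the deck group.\<close>

definition infinite_cyclic_covering ::
  "'x::topological_space set \<Rightarrow> 'y::topological_space set \<Rightarrow> ('y \<Rightarrow> 'x) \<Rightarrow> ('y \<Rightarrow> 'y) \<Rightarrow> bool" where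
  "infinite_cyclic_covering X Y p \<tau> \<longleftrightarrow>
     covering_space Y p X \<and> path_connected Y \<and> Y \<noteq> {} \<and>
     (\<forall>h. path h \<and> path_image h \<subseteq> Y \<and> p (pathstart h) = p (pathfinish h) \<longrightarrow>
        (pathstart h = pathfinish h \<longleftrightarrow>
         (\<exists>n::int. n \<noteq> 0 \<and>
            singular_relboundary 1 (top_of_set X) {} (frag_cmul n (frag_of (path_simplex (p \<circ> h))))))) \<and>
     deck_transformation Y p \<tau> \<and>
     (\<forall>\<sigma>. deck_transformation Y p \<sigma> \<longrightarrow> (\<exists>k. \<forall>y\<in>Y. \<sigma> y = deck_power Y \<tau> k y))"

text \<open>The 1-chain \<open>P(\<tau>) c\<close> and the induced module structure on \<open>H\<^sub>1(Y;Q)\<close>.\<close>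

definition chain_act :: "'y set \<Rightarrow> ('y \<Rightarrow> 'y) \<Rightarrow> laurent \<Rightarrow> 'y rat_chain \<Rightarrow> 'y rat_chain" where
  "chain_act Y \<tau> P c = (\<Sum>k\<in>Poly_Mapping.keys P. rat_scale (Poly_Mapping.lookup P k) (rat_chain_map 1 (deck_power Y \<tau> k) c))"

definition alexander_module :: "'y::topological_space set \<Rightarrow> 'y rat_chain set monoid" where
  "alexander_module Y = rat_homology_group 1 (top_of_set Y)"

definition alexander_scale ::
  "'y::topological_space set \<Rightarrow> ('y \<Rightarrow> 'y) \<Rightarrow> laurent \<Rightarrow> 'y rat_chain set \<Rightarrow> 'y rat_chain set" where
  "alexander_scale Y \<tau> P C = (\<Union>c\<in>C. rat_homology_class 1 (top_of_set Y) (chain_act Y \<tau> P c))"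


section \<open>Intersection numbers and the Blanchfield form\<close>

text \<open>A tube \<open>f\<close> in \<open>Y\<close> preserves orientations, where \<open>Y\<close> has the orientation lifted from \<open>(M,Z)\<close>
  along \<open>p\<close>: the image of a small positively oriented affine 3-simplex of \<open>S\<^sup>1 \<times> C\<close> with barycentre
  \<open>(1,0)\<close> represents the local orientation of \<open>M\<close>. The (rescaled) vertices \<open>(-1,-1,-1)\<close>,
  \<open>e\<^sub>1\<close>, \<open>e\<^sub>2\<close>, \<open>e\<^sub>3\<close> are written in the coordinates (angle, Re, Im).\<close>

definition positive_tube ::
  "'x::t2_space set \<Rightarrow> 'x chain \<Rightarrow> ('y \<Rightarrow> 'x) \<Rightarrow> (complex \<times> complex \<Rightarrow> 'y) \<Rightarrow> bool" where
  "positive_tube M Z p f \<longleftrightarrow>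
     (\<forall>\<^sub>F \<epsilon> in at_right (0::real).
        homologous_rel 3 (top_of_set M) (M - {p (f (1, 0))})
          (frag_of (restrict (\<lambda>x. p (f (cis (\<epsilon> * (x 1 - x 0)),
                                        Complex (\<epsilon> * (x 2 - x 0)) (\<epsilon> * (x 3 - x 0)))))
                             (standard_simplex 3)))
          Z)"

text \<open>The oriented meridian disc \<open>1 \<times> D\<^sup>2\<close>, as a triangle with barycentre on the knot.\<close>

definition meridian_disc :: "(complex \<times> complex \<Rightarrow> 'y) \<Rightarrow> (nat \<Rightarrow> real) \<Rightarrow> 'y" where
  "meridian_disc f = restrict (\<lambda>x. f (1, Complex (x 1 - x 0) (x 2 - x 0))) (standard_simplex 2)"

text \<open>For a positive tube around a knot \<open>\<mu>\<close>, the group \<open>H\<^sub>2(Y, Y - \<mu>; Q)\<close> is the line generated by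
  the meridian disc, whose intersection number with \<open>\<mu>\<close> is \<open>1\<close>. Hence the algebraic intersection
  number of \<open>\<mu>\<close> with a rational 2-chain \<open>S\<close> with boundary off \<open>\<mu>\<close> is the coefficient of \<open>S\<close> there.\<close>

definition intersection_number ::
  "'y::topological_space set \<Rightarrow> 'y rat_chain \<Rightarrow> (complex \<times> complex \<Rightarrow> 'y) \<Rightarrow> rat" where
  "intersection_number Y S f =
     (THE r. \<exists>T \<in> rat_chains 3 (top_of_set Y). \<exists>U \<in> rat_chains 2 (top_of_set (Y - knot_of f)).
        S - Poly_Mapping.single (meridian_disc f) r = rat_boundary 3 T + U)"

definition knot_cycle :: "(complex \<times> complex \<Rightarrow> 'y) \<Rightarrow> 'y rat_chain" where
  "knot_cycle f = Poly_Mapping.single (knot_simplex f) 1"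

text \<open>Integral classes are represented by knots, and rational multiples of them exhaust
  \<open>H\<^sub>1(Y;Q)\<close>; sesquilinearity therefore extends the defining formula to all pairs of classes.
  It also yields independence of the choices of disjoint representatives, of \<open>P\<close> and of \<open>S\<close>.\<close>

definition blanchfield_form ::
  "'x::t2_space set \<Rightarrow> 'x chain \<Rightarrow> 'y::topological_space set \<Rightarrow> ('y \<Rightarrow> 'x) \<Rightarrow> ('y \<Rightarrow> 'y) \<Rightarrow>
   ('y rat_chain set \<Rightarrow> 'y rat_chain set \<Rightarrow> fract_mod_laurent) \<Rightarrow> bool" where
  "blanchfield_form M Z Y p \<tau> B \<longleftrightarrow>
     (let A = alexander_module Y in
      (\<forall>x \<in> carrier A. \<forall>y \<in> carrier A. \<forall>z \<in> carrier A.
         B (x \<otimes>\<^bsub>A\<^esub> y) z = fml_add (B x z) (B y z) \<and> B x (y \<otimes>\<^bsub>A\<^esub> z) = fml_add (B x y) (B x z)) \<and>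
      (\<forall>x \<in> carrier A. \<forall>y \<in> carrier A. \<forall>P.
         B (alexander_scale Y \<tau> P x) y = fml_scale P (B x y) \<and>
         B x (alexander_scale Y \<tau> P y) = fml_scale (laurent_conj P) (B x y)) \<and>
      (\<forall>f1 f2 P S.
         knot_tube Y f1 \<and> knot_tube Y f2 \<and> positive_tube M Z p f2 \<and>
         (\<forall>k. knot_of f1 \<inter> deck_power Y \<tau> k ` knot_of f2 = {}) \<and>
         P \<noteq> 0 \<and> S \<in> rat_chains 2 (top_of_set Y) \<and>
         rat_boundary 2 S = chain_act Y \<tau> P (knot_cycle f1) \<longrightarrow>
         B (rat_homology_class 1 (top_of_set Y) (knot_cycle f1))
           (rat_homology_class 1 (top_of_set Y) (knot_cycle f2)) =
         fml_class (Fract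
           (Sum_any (\<lambda>k. Poly_Mapping.single k (intersection_number Y S (deck_power Y \<tau> k \<circ> f2)))) P)))"

text \<open>A closed 3-manifold and the infinite cyclic coverings considered here (3-manifolds with
  boundary, with countable basis) embed in 7-dimensional Euclidean space, so that taking them
  to be subsets of this space is no loss of generality.\<close>

definition blanchfield_module ::
  "(laurent \<Rightarrow> 'a::ab_group_add \<Rightarrow> 'a) \<Rightarrow> ('a \<Rightarrow> 'a \<Rightarrow> fract_mod_laurent) \<Rightarrow> bool" where
  "blanchfield_module act b \<longleftrightarrow>
     module act \<and>
     (\<exists>(M :: (real^7) set) Z K X (Y :: (real^7) set) p \<tau> B \<phi>.
        QSK_pair M Z K \<and> knot_exterior M K X \<and> infinite_cyclic_covering X Y p \<tau> \<and>
        blanchfield_form M Z Y p \<tau> B \<and>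
        \<phi> \<in> iso (additive_group UNIV) (alexander_module Y) \<and>
        (\<forall>P x. \<phi> (act P x) = alexander_scale Y \<tau> P (\<phi> x)) \<and>
        (\<forall>x y. b x y = B (\<phi> x) (\<phi> y)))"


section \<open>Decompositions\<close>

text \<open>The family \<open>\<eta>\<close> is indexed by \<open>1, \<dots>, q\<close> and its involution is given on indices, so that
  \<open>d(\<eta>\<^sub>i)\<close> is \<open>\<eta> (d i)\<close>.\<close>

definition blanchfield_decomposition ::
  "(laurent \<Rightarrow> 'a::ab_group_add \<Rightarrow> 'a) \<Rightarrow> ('a \<Rightarrow> 'a \<Rightarrow> fract_mod_laurent) \<Rightarrow> nat \<Rightarrow> (nat \<Rightarrow> 'a) \<Rightarrow>
   (nat \<Rightarrow> nat) \<Rightarrow> (nat \<Rightarrow> laurent) \<Rightarrow> (nat \<Rightarrow> rat poly) \<Rightarrow> (nat \<Rightarrow> nat) \<Rightarrow> bool" where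
  "blanchfield_decomposition act b q \<eta> d a \<delta> m \<longleftrightarrow>
     d ` {1..q} \<subseteq> {1..q} \<and> (\<forall>i\<in>{1..q}. d (d i) = i) \<and>
     \<comment> \<open>direct sum of the submodules generated by the \<open>\<eta>\<^sub>i\<close>, whose annihilators are \<open>(\<delta>\<^sub>i)\<close>\<close>
     (\<forall>x. \<exists>!f. f \<in> (\<Pi>\<^sub>E i\<in>{1..q}. range (\<lambda>P. act P (\<eta> i))) \<and> x = (\<Sum>i=1..q. f i)) \<and>
     (\<forall>i\<in>{1..q}. \<forall>P. act P (\<eta> i) = 0 \<longleftrightarrow> laurent_of_poly (\<delta> i) dvd P) \<and>
     (\<forall>i\<in>{1..q}. \<forall>j\<in>{1..q}. i \<noteq> j \<longrightarrow> b (\<eta> i) (\<eta> (d j)) = fml_zero) \<and>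
     (\<forall>i\<in>{1..q}. \<exists>\<pi>. prime_elem \<pi> \<and> \<delta> i = \<pi> ^ m i) \<and>
     (\<forall>i\<in>{1..q}. b (\<eta> i) (\<eta> (d i)) = fml_class (Fract (a i) (laurent_of_poly (\<delta> i)))) \<and>
     \<comment> \<open>\<open>a\<^sub>i\<close> is prime to \<open>\<delta>\<^sub>i\<close>\<close>
     (\<forall>i\<in>{1..q}. \<forall>c. c dvd a i \<longrightarrow> c dvd laurent_of_poly (\<delta> i) \<longrightarrow> c dvd 1) \<and>
     (\<forall>i\<in>{1..<q}. m (i + 1) \<le> m i) \<and>
     (\<forall>i\<in>{1..q}. poly (\<delta> i) 0 \<noteq> 0 \<and> poly (\<delta> i) 1 = 1)"


section \<open>The exterior cube and the space \<open>H\<close>\<close>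

text \<open>\<open>\<Lambda>\<^sup>3\<close> over the rationals is the free rational vector space on triples modulo multilinearity and
  alternation; \<open>c \<in> Q\<close> acts on the module as the constant Laurent polynomial.\<close>

type_synonym 'a triples = "('a \<times> 'a \<times> 'a) \<Rightarrow>\<^sub>0 rat"

definition triple :: "'a \<Rightarrow> 'a \<Rightarrow> 'a \<Rightarrow> 'a triples" where
  "triple x y z = Poly_Mapping.single (x, y, z) 1"

inductive_set wedge_relators :: "(laurent \<Rightarrow> 'a::ab_group_add \<Rightarrow> 'a) \<Rightarrow> 'a triples set"
  for act :: "laurent \<Rightarrow> 'a::ab_group_add \<Rightarrow> 'a" where
  add1: "triple (x + x') y z - triple x y z - triple x' y z \<in> wedge_relators act"
| add2: "triple x (y + y') z - triple x y z - triple x y' z \<in> wedge_relators act"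
| add3: "triple x y (z + z') - triple x y z - triple x y z' \<in> wedge_relators act"
| scale1: "triple (act (Poly_Mapping.single 0 c) x) y z - rat_scale c (triple x y z) \<in> wedge_relators act"
| scale2: "triple x (act (Poly_Mapping.single 0 c) y) z - rat_scale c (triple x y z) \<in> wedge_relators act"
| scale3: "triple x y (act (Poly_Mapping.single 0 c) z) - rat_scale c (triple x y z) \<in> wedge_relators act"
| alt12: "triple x x y \<in> wedge_relators act"
| alt13: "triple x y x \<in> wedge_relators act"
| alt23: "triple y x x \<in> wedge_relators act"

abbreviation rat_span :: "('k \<Rightarrow>\<^sub>0 rat) set \<Rightarrow> ('k \<Rightarrow>\<^sub>0 rat) set" where
  "rat_span \<equiv> module.span rat_scale"

definition Lambda3 :: "(laurent \<Rightarrow> 'a::ab_group_add \<Rightarrow> 'a) \<Rightarrow> 'a triples set monoid" where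
  "Lambda3 act = additive_group UNIV Mod rat_span (wedge_relators act)"

definition Lambda3_class ::
  "(laurent \<Rightarrow> 'a::ab_group_add \<Rightarrow> 'a) \<Rightarrow> 'a triples \<Rightarrow> 'a triples set" where
  "Lambda3_class act v = rat_span (wedge_relators act) #>\<^bsub>additive_group UNIV\<^esub> v"

text \<open>Subspaces of a quotient generated by classes are written as images of the subspaces
  generated by representatives, the quotient maps being linear.\<close>

definition t_relations :: "(laurent \<Rightarrow> 'a::ab_group_add \<Rightarrow> 'a) \<Rightarrow> 'a triples set set" where
  "t_relations act =
     (let t = act (Poly_Mapping.single 1 1) in
      Lambda3_class act ` rat_span {triple x y z - triple (t x) (t y) (t z) | x y z. True})"

definition H_space :: "(laurent \<Rightarrow> 'a::ab_group_add \<Rightarrow> 'a) \<Rightarrow> 'a triples set set monoid" where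
  "H_space act = Lambda3 act Mod t_relations act"

definition H_class ::
  "(laurent \<Rightarrow> 'a::ab_group_add \<Rightarrow> 'a) \<Rightarrow> 'a triples \<Rightarrow> 'a triples set set" where
  "H_class act v = t_relations act #>\<^bsub>Lambda3 act\<^esub> Lambda3_class act v"

definition H_subspace ::
  "(laurent \<Rightarrow> 'a::ab_group_add \<Rightarrow> 'a) \<Rightarrow> (nat \<Rightarrow> 'a) \<Rightarrow> nat \<Rightarrow> nat \<Rightarrow> nat \<Rightarrow> 'a triples set set set" where
  "H_subspace act \<eta> i1 i2 i3 =
     (let t = (\<lambda>k::int. act (Poly_Mapping.single k 1)) in
      H_class act `
        rat_span {triple (t k1 (\<eta> i1)) (t k2 (\<eta> i2)) (t k3 (\<eta> i3)) | k1 k2 k3. True})"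

end

theory Submission
  imports Defs
    "HOL-Computational_Algebra.Fundamental_Theorem_Algebra"
    "HOL-Computational_Algebra.Polynomial_Factorial"
    "HOL-Computational_Algebra.Field_as_Ring"
begin

text \<open>
Since \<open>H\<close> is a quotient of a vector space, \<open>H(i)\<close> is nontrivial if and only if some linear form on \<open>H\<close>
is nonzero on one of its generators. Such forms, with complex values, are the alternating
rational-trilinear forms \<open>F\<close> on the module that satisfy \<open>F(tx, ty, tz) = F(x, y, z)\<close>
(\<open>H_subspace_nontrivial_iff_form\<close>). After extension of scalars the summand \<open>A\<^sub>i\<close> becomes
\<open>C[t]/(\<delta>\<^sub>i)\<close>, and as \<open>\<delta>\<^sub>i\<close> is the \<open>m\<^sub>i\<close>-th power of a polynomial with simple roots, this is the direct sum
of the primary components \<open>C[t]/(t - z)\<^sup>m\<close>, \<open>m = m\<^sub>i\<close>, over the roots \<open>z\<close>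
(\<open>prime_power_root_multiplicity\<close>).

Given \<open>F\<close>, the numbers \<open>F(t\<^sup>a \<eta>, t\<^sup>b \<eta>', t\<^sup>c \<eta>'')\<close> define a trilinear form on \<open>C[t]\<close>. It is nonzero on some
product of primary components, belonging to roots \<open>z\<^sub>1, z\<^sub>2, z\<^sub>3\<close>. There \<open>t \<otimes> t \<otimes> t\<close> has the single
eigenvalue \<open>z\<^sub>1 z\<^sub>2 z\<^sub>3\<close>, which must be \<open>1\<close> by invariance. Slots with equal index and equal root share one
primary component, of dimension \<open>m\<close>, and the form is alternating in them; as it is nonzero, their number
is at most \<open>m\<close> (\<open>admissible_roots\<close>).

Conversely, given roots as in the theorem, let \<open>\<phi>\<^sub>j\<close> be the functional with \<open>t\<^sup>k \<eta> \<mapsto> k\<^sup>r z\<^sub>j\<^sup>k\<close> on the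
summand of the \<open>j\<close>-th slot and zero on the others, where \<open>r\<close> is the number of earlier slots with the same
index and root. It is well defined because \<open>r\<close> is less than the multiplicity. The action of \<open>t\<close> on the
\<open>\<phi>\<^sub>j\<close> is triangular with diagonal \<open>z\<^sub>1, z\<^sub>2, z\<^sub>3\<close>, so the determinant of the matrix \<open>\<phi>\<^sub>j(x\<^sub>l)\<close> is an
invariant alternating form, and confluent Vandermonde determinants show that it does not vanish on
\<open>H(i)\<close> (\<open>form_from_roots\<close>).
\<close>

section \<open>Linear and trilinear forms on complex polynomials\<close>

text \<open>Complex-linear functionals on \<open>C[t]\<close>, as plain functions.\<close>

definition linear_on_poly :: "(complex poly \<Rightarrow> complex) \<Rightarrow> bool" where
  "linear_on_poly \<Phi> \<longleftrightarrow> (\<forall>c p q. \<Phi> (smult c p + q) = c * \<Phi> p + \<Phi> q)"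

lemma linear_on_poly_add: "linear_on_poly \<Phi> \<Longrightarrow> \<Phi> (p + q) = \<Phi> p + \<Phi> q"
  unfolding linear_on_poly_def by (metis mult_1 smult_1_left)

lemma linear_on_poly_0: "linear_on_poly \<Phi> \<Longrightarrow> \<Phi> 0 = 0"
  using linear_on_poly_add[of \<Phi> 0 0] by simp

lemma linear_on_poly_smult: "linear_on_poly \<Phi> \<Longrightarrow> \<Phi> (smult c p) = c * \<Phi> p"
  unfolding linear_on_poly_def using linear_on_poly_0 linear_on_poly_def by (metis add.right_neutral)

lemma linear_on_poly_comp_mult:
  assumes "linear_on_poly \<Phi>"
  shows "linear_on_poly (\<lambda>p. \<Phi> (e * p))"
  using assms unfolding linear_on_poly_def by (simp add: distrib_left)

text \<open>The Nullstellensatz in one variable: an element of least degree generates the ideal, and a generator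
of positive degree would have a root.\<close>

lemma one_in_ideal_if_no_common_root:
  fixes I :: "complex poly set"
  assumes add: "\<And>p q. p \<in> I \<Longrightarrow> q \<in> I \<Longrightarrow> p + q \<in> I"
    and mult: "\<And>p q. p \<in> I \<Longrightarrow> q * p \<in> I"
    and no_root: "\<And>z. \<exists>p\<in>I. poly p z \<noteq> 0"
  shows "1 \<in> I"
proof -
  define g where "g = arg_min degree (\<lambda>p. p \<in> I \<and> p \<noteq> 0)"
  obtain p0 where p0: "p0 \<in> I" "p0 \<noteq> 0" using no_root[of 0] by force
  have g: "g \<in> I" "g \<noteq> 0" and min: "\<And>p. p \<in> I \<Longrightarrow> p \<noteq> 0 \<Longrightarrow> degree g \<le> degree p"
    using arg_min_nat_lemma[of "\<lambda>p. p \<in> I \<and> p \<noteq> 0" p0 degree] p0 unfolding g_def by auto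
  have dvd: "g dvd p" if "p \<in> I" for p
  proof (rule ccontr)
    assume "\<not> g dvd p"
    then have nz: "p mod g \<noteq> 0" by (simp add: dvd_eq_mod_eq_0)
    have "p mod g = p + (- (p div g)) * g"
      by (simp add: minus_div_mult_eq_mod[symmetric])
    then have "p mod g \<in> I" using add[OF that mult[OF g(1)], of "- (p div g)"] by simp
    moreover have "degree (p mod g) < degree g"
      using degree_mod_less'[OF g(2) nz] .
    ultimately show False using min nz by fastforce
  qed
  have "degree g = 0"
  proof (rule ccontr)
    assume "degree g \<noteq> 0"
    then obtain z where "poly g z = 0"
      using fundamental_theorem_of_algebra[of g] by (auto simp: constant_degree)
    then show False using dvd no_root[of z] by (metis dvd_trans poly_eq_0_iff_dvd)
  qed
  then obtain c where c: "g = [:c:]" "c \<noteq> 0" using g(2) by (metis degree_eq_zeroE pCons_0_0)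
  then show ?thesis using mult[OF g(1), of "[:inverse c:]"] by (simp add: one_pCons)
qed

text \<open>In the applications \<open>e z\<close> is the cofactor of the power of \<open>t - z\<close> in \<open>\<delta>\<close>, so that multiplication by
\<open>e z\<close> projects \<open>C[t]/(\<delta>)\<close> onto its \<open>z\<close>-primary component, up to a unit there. The polynomial \<open>\<delta>\<close>
and all cofactors together have no common root, hence they generate the unit ideal.\<close>

lemma nonzero_on_primary_component:
  assumes lin: "linear_on_poly \<Phi>"
    and ann: "\<And>p. \<Phi> (\<delta> * p) = 0"
    and e: "\<And>z. poly \<delta> z = 0 \<Longrightarrow> poly (e z) z \<noteq> 0"
    and nz: "\<Phi> P \<noteq> 0"
  obtains z p where "poly \<delta> z = 0" "\<Phi> (e z * p) \<noteq> 0"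
proof -
  let ?I = "{q. \<forall>p. \<Phi> (q * p) = 0}"
  have "\<exists>z p. poly \<delta> z = 0 \<and> \<Phi> (e z * p) \<noteq> 0"
  proof (rule ccontr)
    assume "\<not> ?thesis"
    then have *: "e z \<in> ?I" if "poly \<delta> z = 0" for z using that by blast
    have "1 \<in> ?I"
    proof (rule one_in_ideal_if_no_common_root)
      fix z show "\<exists>p\<in>?I. poly p z \<noteq> 0"
        using * e ann by (cases "poly \<delta> z = 0") blast+
    next
      fix p q assume "p \<in> ?I" "q \<in> ?I" then show "p + q \<in> ?I"
        using linear_on_poly_add[OF lin] by (simp add: distrib_right)
    next
      fix p q assume p: "p \<in> ?I"
      then have "\<Phi> (p * (q * r)) = 0" for r by blast
      then show "q * p \<in> ?I" by (simp add: mult_ac)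
    qed
    then show False using nz by simp
  qed
  then show ?thesis using that by blast
qed

definition trilinear_on_poly :: "(complex poly \<Rightarrow> complex poly \<Rightarrow> complex poly \<Rightarrow> complex) \<Rightarrow> bool" where
  "trilinear_on_poly T \<longleftrightarrow> (\<forall>Q R. linear_on_poly (\<lambda>P. T P Q R)) \<and>
     (\<forall>P R. linear_on_poly (\<lambda>Q. T P Q R)) \<and> (\<forall>P Q. linear_on_poly (\<lambda>R. T P Q R))"

lemma trilinear_on_poly_lin:
  assumes "trilinear_on_poly T"
  shows "linear_on_poly (\<lambda>P. T P Q R)" "linear_on_poly (\<lambda>Q. T P Q R)" "linear_on_poly (\<lambda>R. T P Q R)"
  using assms unfolding trilinear_on_poly_def by auto

lemma trilinear_on_poly_comp_mult:
  assumes "trilinear_on_poly T"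
  shows "trilinear_on_poly (\<lambda>P Q R. T (e1 * P) (e2 * Q) (e3 * R))"
  unfolding trilinear_on_poly_def
  by (intro conjI allI linear_on_poly_comp_mult trilinear_on_poly_lin[OF assms])

lemma linear_on_poly_eigen:
  assumes lin: "linear_on_poly \<Phi>" and "\<Phi> ([:-z, 1:] * p) = 0"
  shows "\<Phi> ([:0, 1:] * p) = z * \<Phi> p"
proof -
  have "[:0, 1:] * p = [:-z, 1:] * p + smult z p" by simp
  then show ?thesis
    using linear_on_poly_add[OF lin] linear_on_poly_smult[OF lin] assms(2) by (metis add_0)
qed

text \<open>Each variable acts with the single eigenvalue \<open>z\<^sub>j\<close>. Applying as many factors \<open>t - z\<^sub>j\<close> as possible
without annihilating \<open>T\<close> yields a nonzero form on which the variables act as the scalars \<open>z\<^sub>j\<close>.\<close>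

lemma product_of_eigenvalues_eq_1:
  assumes T: "trilinear_on_poly T"
    and inv: "\<And>P Q R. T ([:0, 1:] * P) ([:0, 1:] * Q) ([:0, 1:] * R) = T P Q R"
    and ann1: "\<And>P Q R. T ([:-z1, 1:] ^ m1 * P) Q R = 0"
    and ann2: "\<And>P Q R. T P ([:-z2, 1:] ^ m2 * Q) R = 0"
    and ann3: "\<And>P Q R. T P Q ([:-z3, 1:] ^ m3 * R) = 0"
    and nz: "T P0 Q0 R0 \<noteq> 0"
  shows "z1 * z2 * z3 = 1"
proof -
  \<comment> \<open>\<open>?S n\<close>: some \<open>n\<close> factors, distributed over the three slots, do not annihilate \<open>T\<close>\<close>
  let ?V = "\<lambda>a b c P Q R. T ([:-z1, 1:] ^ a * P) ([:-z2, 1:] ^ b * Q) ([:-z3, 1:] ^ c * R)"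
  let ?S = "\<lambda>n. \<exists>a b c. n = a + b + c \<and> (\<exists>P Q R. ?V a b c P Q R \<noteq> 0)"
  have bound: "n \<le> m1 + m2 + m3" if "?S n" for n
  proof -
    obtain a b c P Q R where n: "n = a + b + c" and V: "?V a b c P Q R \<noteq> 0" using \<open>?S n\<close> by blast
    have "a < m1"
    proof (rule ccontr)
      assume "\<not> a < m1"
      then have "[:-z1, 1:] ^ a * P = [:-z1, 1:] ^ m1 * ([:-z1, 1:] ^ (a - m1) * P)"
        by (metis mult.assoc power_add le_add_diff_inverse not_less)
      with ann1 V show False by simp
    qed
    moreover have "b < m2"
    proof (rule ccontr)
      assume "\<not> b < m2"
      then have "[:-z2, 1:] ^ b * Q = [:-z2, 1:] ^ m2 * ([:-z2, 1:] ^ (b - m2) * Q)"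
        by (metis mult.assoc power_add le_add_diff_inverse not_less)
      with ann2 V show False by simp
    qed
    moreover have "c < m3"
    proof (rule ccontr)
      assume "\<not> c < m3"
      then have "[:-z3, 1:] ^ c * R = [:-z3, 1:] ^ m3 * ([:-z3, 1:] ^ (c - m3) * R)"
        by (metis mult.assoc power_add le_add_diff_inverse not_less)
      with ann3 V show False by simp
    qed
    ultimately show ?thesis using n by simp
  qed
  have "?S 0" using nz by (intro exI[of _ 0]) auto
  then obtain n where n: "?S n" and max: "\<And>k. ?S k \<Longrightarrow> k \<le> n"
    using Nat.ex_has_greatest_nat[of ?S 0 "m1 + m2 + m3"] bound by blast
  obtain a b c P Q R where abc: "n = a + b + c" and V: "?V a b c P Q R \<noteq> 0" using n by blast
  define W where "W = ?V a b c"
  have triW: "trilinear_on_poly W" unfolding W_def by (rule trilinear_on_poly_comp_mult[OF T])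
  have 1: "W ([:-z1, 1:] * P) Q R = 0" for P Q R
  proof (rule ccontr)
    assume "W ([:-z1, 1:] * P) Q R \<noteq> 0"
    then have "?V (Suc a) b c P Q R \<noteq> 0"
      unfolding W_def power_Suc by (simp only: mult_ac not_False_eq_True)
    then have "?S (Suc n)" using abc by (intro exI[of _ "Suc a"] exI[of _ b] exI[of _ c]) auto
    then show False using max by fastforce
  qed
  have 2: "W P ([:-z2, 1:] * Q) R = 0" for P Q R
  proof (rule ccontr)
    assume "W P ([:-z2, 1:] * Q) R \<noteq> 0"
    then have "?V a (Suc b) c P Q R \<noteq> 0"
      unfolding W_def power_Suc by (simp only: mult_ac not_False_eq_True)
    then have "?S (Suc n)" using abc by (intro exI[of _ a] exI[of _ "Suc b"] exI[of _ c]) auto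
    then show False using max by fastforce
  qed
  have 3: "W P Q ([:-z3, 1:] * R) = 0" for P Q R
  proof (rule ccontr)
    assume "W P Q ([:-z3, 1:] * R) \<noteq> 0"
    then have "?V a b (Suc c) P Q R \<noteq> 0"
      unfolding W_def power_Suc by (simp only: mult_ac not_False_eq_True)
    then have "?S (Suc n)" using abc by (intro exI[of _ a] exI[of _ b] exI[of _ "Suc c"]) auto
    then show False using max by fastforce
  qed
  note lin = trilinear_on_poly_lin[OF triW]
  have "W ([:0, 1:] * P) ([:0, 1:] * Q) ([:0, 1:] * R) = z1 * (z2 * (z3 * W P Q R))"
    using linear_on_poly_eigen[OF lin(1) 1] linear_on_poly_eigen[OF lin(2) 2]
      linear_on_poly_eigen[OF lin(3) 3] by simp
  moreover have "W ([:0, 1:] * P) ([:0, 1:] * Q) ([:0, 1:] * R) = W P Q R"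
    using inv[of "[:-z1, 1:] ^ a * P" "[:-z2, 1:] ^ b * Q" "[:-z3, 1:] ^ c * R"]
    unfolding W_def by (simp only: mult_ac)
  ultimately have "(z1 * z2 * z3) * W P Q R = 1 * W P Q R" by (simp only: mult.assoc mult_1)
  moreover have "W P Q R \<noteq> 0" using V unfolding W_def .
  ultimately show ?thesis unfolding mult_cancel_right by blast
qed

lemma linear_on_poly_annihilated_by_linear:
  assumes lin: "linear_on_poly \<Phi>" and ann: "\<And>p. \<Phi> ([:-z, 1:] * p) = 0"
  shows "\<Phi> p = poly p z * \<Phi> 1"
proof -
  have "[:-z, 1:] dvd p - [:poly p z:]" by (simp add: poly_eq_0_iff_dvd[symmetric])
  then obtain r where "p - [:poly p z:] = [:-z, 1:] * r" by (auto elim: dvdE)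
  then have "p = [:-z, 1:] * r + smult (poly p z) 1" by (simp add: algebra_simps one_pCons)
  then show ?thesis
    using linear_on_poly_add[OF lin, of "[:-z, 1:] * r" "smult (poly p z) 1"]
      linear_on_poly_smult[OF lin, of "poly p z" 1] ann[of r] by simp
qed

text \<open>Taylor expansion of \<open>p\<close> at \<open>z\<close> to first order; the coefficients do not depend on the functional.\<close>

lemma linear_on_poly_mod_square:
  obtains c0 c1 where "\<And>\<Phi>. linear_on_poly \<Phi> \<Longrightarrow> (\<And>p. \<Phi> ([:-z, 1:] ^ 2 * p) = 0) \<Longrightarrow>
    \<Phi> p = c0 * \<Phi> 1 + c1 * \<Phi> [:-z, 1:]"
proof -
  have "[:-z, 1:] dvd p - [:poly p z:]" by (simp add: poly_eq_0_iff_dvd[symmetric])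
  then obtain r where r: "p - [:poly p z:] = [:-z, 1:] * r" by (auto elim: dvdE)
  have "[:-z, 1:] dvd r - [:poly r z:]" by (simp add: poly_eq_0_iff_dvd[symmetric])
  then obtain s where s: "r - [:poly r z:] = [:-z, 1:] * s" by (auto elim: dvdE)
  have "p = [:-z, 1:] * ([:-z, 1:] * s + [:poly r z:]) + [:poly p z:]"
    unfolding s[symmetric] by (simp add: r[symmetric] del: mult_pCons_left)
  also have "\<dots> = [:-z, 1:] ^ 2 * s + (smult (poly p z) 1 + smult (poly r z) [:-z, 1:])"
    by (simp only: distrib_left power2_eq_square mult.assoc add.assoc) (simp add: one_pCons)
  finally have *: "p = [:-z, 1:] ^ 2 * s + (smult (poly p z) 1 + smult (poly r z) [:-z, 1:])" .
  show ?thesis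
  proof (rule that)
    fix \<Phi> assume "linear_on_poly \<Phi>" "\<And>p. \<Phi> ([:-z, 1:] ^ 2 * p) = 0"
    then show "\<Phi> p = poly p z * \<Phi> 1 + poly r z * \<Phi> [:-z, 1:]"
      using linear_on_poly_add[of \<Phi> "[:-z, 1:] ^ 2 * s"] 
        linear_on_poly_add[of \<Phi> "smult (poly p z) 1" "smult (poly r z) [:-z, 1:]"]
        linear_on_poly_smult[of \<Phi> "poly p z" 1] linear_on_poly_smult[of \<Phi> "poly r z" "[:-z, 1:]"]
      by (subst *) simp
  qed
qed

text \<open>The second exterior power of the line \<open>C[t]/(t - z)\<close> is zero.\<close>

lemma skew_bilinear_eq_0:
  assumes lin1: "\<And>Q. linear_on_poly (\<lambda>P. B P Q)" and lin2: "\<And>P. linear_on_poly (\<lambda>Q. B P Q)"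
    and skew: "\<And>P Q. B P Q = - B Q P"
    and ann: "\<And>P Q. B ([:-z, 1:] * P) Q = 0"
  shows "B P Q = 0"
proof -
  have ann2: "B P ([:-z, 1:] * Q) = 0" for P Q using ann[of Q P] skew[of P "[:-z, 1:] * Q"] by simp
  have "B P Q = poly P z * (poly Q z * B 1 1)"
    using linear_on_poly_annihilated_by_linear[OF lin1 ann]
      linear_on_poly_annihilated_by_linear[OF lin2 ann2] by metis
  moreover have "B 1 1 = 0" using skew[of 1 1] by simp
  ultimately show ?thesis by simp
qed

text \<open>The third exterior power of the plane \<open>C[t]/(t - z)\<^sup>2\<close> is zero: after expansion in the basis
\<open>1, t - z\<close> every term has a repeated argument.\<close>

lemma skew_trilinear_eq_0:
  assumes T: "trilinear_on_poly T"
    and skew12: "\<And>P Q R. T P Q R = - T Q P R" and skew23: "\<And>P Q R. T P Q R = - T P R Q"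
    and ann: "\<And>P Q R. T ([:-z, 1:] ^ 2 * P) Q R = 0"
  shows "T P Q R = 0"
proof -
  have ann2: "T P ([:-z, 1:] ^ 2 * Q) R = 0" for P Q R using ann skew12 by (metis neg_equal_0_iff_equal)
  have ann3: "T P Q ([:-z, 1:] ^ 2 * R) = 0" for P Q R using ann2 skew23 by (metis neg_equal_0_iff_equal)
  note lin = trilinear_on_poly_lin[OF T]
  let ?l = "[:-z, 1:]"
  have exp: "\<exists>c0 c1. \<forall>\<Phi>. linear_on_poly \<Phi> \<longrightarrow> (\<forall>p. \<Phi> (?l ^ 2 * p) = 0) \<longrightarrow> \<Phi> p = c0 * \<Phi> 1 + c1 * \<Phi> ?l" for p
    by (rule linear_on_poly_mod_square[of z p]) blast
  obtain p0 p1 where P: "T P Q R = p0 * T 1 Q R + p1 * T ?l Q R" for Q R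
    using exp[of P] lin(1) ann by meson
  obtain q0 q1 where Q: "T P Q R = q0 * T P 1 R + q1 * T P ?l R" for P R
    using exp[of Q] lin(2) ann2 by meson
  obtain r0 r1 where R: "T P Q R = r0 * T P Q 1 + r1 * T P Q ?l" for P Q
    using exp[of R] lin(3) ann3 by meson
  have 12: "T A A B = 0" for A B using skew12[of A A B] by simp
  have 23: "T B A A = 0" for A B using skew23[of B A A] by simp
  have 13: "T A B A = 0" for A B using skew12[of A B A] 23 by simp
  show ?thesis by (simp only: P Q R 12 23 13) simp
qed

text \<open>A nonzero form on \<open>C[t]/(\<delta>\<^sub>1) \<times> C[t]/(\<delta>\<^sub>2) \<times> C[t]/(\<delta>\<^sub>3)\<close> invariant under the diagonal action of \<open>t\<close> is
nonzero on some product of primary components, and the eigenvalues there multiply to \<open>1\<close>.\<close>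

lemma common_point:
  assumes T: "trilinear_on_poly T"
    and inv: "\<And>P Q R. T ([:0, 1:] * P) ([:0, 1:] * Q) ([:0, 1:] * R) = T P Q R"
    and ann1: "\<And>P Q R. T (\<delta>1 * P) Q R = 0"
    and ann2: "\<And>P Q R. T P (\<delta>2 * Q) R = 0"
    and ann3: "\<And>P Q R. T P Q (\<delta>3 * R) = 0"
    and e1: "\<And>z. poly \<delta>1 z = 0 \<Longrightarrow> \<delta>1 = [:-z, 1:] ^ m1 * e1 z \<and> poly (e1 z) z \<noteq> 0"
    and e2: "\<And>z. poly \<delta>2 z = 0 \<Longrightarrow> \<delta>2 = [:-z, 1:] ^ m2 * e2 z \<and> poly (e2 z) z \<noteq> 0"
    and e3: "\<And>z. poly \<delta>3 z = 0 \<Longrightarrow> \<delta>3 = [:-z, 1:] ^ m3 * e3 z \<and> poly (e3 z) z \<noteq> 0"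
    and nz: "T P0 Q0 R0 \<noteq> 0"
  obtains z1 z2 z3 P Q R where "poly \<delta>1 z1 = 0" "poly \<delta>2 z2 = 0" "poly \<delta>3 z3 = 0"
    "z1 * z2 * z3 = 1" "T (e1 z1 * P) (e2 z2 * Q) (e3 z3 * R) \<noteq> 0"
proof -
  note lin = trilinear_on_poly_lin[OF T]
  obtain z1 P where z1: "poly \<delta>1 z1 = 0" "T (e1 z1 * P) Q0 R0 \<noteq> 0"
    using nonzero_on_primary_component[OF lin(1) ann1 _ nz] e1 by metis
  obtain z2 Q where z2: "poly \<delta>2 z2 = 0" "T (e1 z1 * P) (e2 z2 * Q) R0 \<noteq> 0"
    using nonzero_on_primary_component[OF lin(2) ann2 _ z1(2)] e2 by metis
  obtain z3 R where z3: "poly \<delta>3 z3 = 0" "T (e1 z1 * P) (e2 z2 * Q) (e3 z3 * R) \<noteq> 0"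
    using nonzero_on_primary_component[OF lin(3) ann3 _ z2(2)] e3 by metis
  let ?T = "\<lambda>P Q R. T (e1 z1 * P) (e2 z2 * Q) (e3 z3 * R)"
  have "z1 * z2 * z3 = 1"
  proof (rule product_of_eigenvalues_eq_1[of ?T])
    show "trilinear_on_poly ?T" by (rule trilinear_on_poly_comp_mult[OF T])
    show "?T ([:0, 1:] * P) ([:0, 1:] * Q) ([:0, 1:] * R) = ?T P Q R" for P Q R
      using inv[of "e1 z1 * P" "e2 z2 * Q" "e3 z3 * R"] by (simp only: mult_ac)
    have "e1 z1 * ([:-z1, 1:] ^ m1 * P) = \<delta>1 * P" for P
      using e1[OF z1(1)] by (simp only: mult_ac)
    then show "?T ([:-z1, 1:] ^ m1 * P) Q R = 0" for P Q R by (simp only: ann1)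
    have "e2 z2 * ([:-z2, 1:] ^ m2 * P) = \<delta>2 * P" for P
      using e2[OF z2(1)] by (simp only: mult_ac)
    then show "?T P ([:-z2, 1:] ^ m2 * Q) R = 0" for P Q R by (simp only: ann2)
    have "e3 z3 * ([:-z3, 1:] ^ m3 * P) = \<delta>3 * P" for P
      using e3[OF z3(1)] by (simp only: mult_ac)
    then show "?T P Q ([:-z3, 1:] ^ m3 * R) = 0" for P Q R by (simp only: ann3)
    show "?T P Q R \<noteq> 0" by (rule z3(2))
  qed
  then show ?thesis using that z1 z2 z3 by blast
qed

section \<open>Forms given by their values on monomials\<close>

text \<open>The linear functional on \<open>C[t]\<close> with \<open>t\<^sup>k \<mapsto> f k\<close>.\<close>

definition coeff_pairing :: "(nat \<Rightarrow> complex) \<Rightarrow> complex poly \<Rightarrow> complex" where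
  "coeff_pairing f p = (\<Sum>k\<le>degree p. coeff p k * f k)"

lemma coeff_pairing_atMost: "degree p \<le> n \<Longrightarrow> coeff_pairing f p = (\<Sum>k\<le>n. coeff p k * f k)"
  unfolding coeff_pairing_def by (rule sum.mono_neutral_left) (auto simp: coeff_eq_0)

lemma linear_coeff_pairing: "linear_on_poly (coeff_pairing f)"
  unfolding linear_on_poly_def
proof (intro allI)
  fix c and p q :: "complex poly"
  define n where "n = max (degree p) (degree q)"
  have "degree (smult c p + q) \<le> n" unfolding n_def
    by (intro degree_add_le) (auto intro: order_trans[OF degree_smult_le])
  then show "coeff_pairing f (smult c p + q) = c * coeff_pairing f p + coeff_pairing f q"
    using coeff_pairing_atMost[of p n f] coeff_pairing_atMost[of q n f]
    by (simp add: coeff_pairing_atMost n_def sum_distrib_left sum.distrib algebra_simps)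
qed

lemma coeff_pairing_monom: "coeff_pairing f (monom c n) = c * f n"
proof -
  have "coeff_pairing f (monom c n) = (\<Sum>k\<le>n. if k = n then c * f n else 0)"
    unfolding coeff_pairing_atMost[OF degree_monom_le] by (intro sum.cong) auto
  then show ?thesis by simp
qed

lemma linear_on_poly_eq_coeff_pairing:
  assumes lin: "linear_on_poly \<Phi>"
  shows "\<Phi> p = coeff_pairing (\<lambda>k. \<Phi> (monom 1 k)) p"
proof -
  have sum: "\<Phi> (sum g A) = (\<Sum>a\<in>A. \<Phi> (g a))" for g and A :: "nat set"
    by (induction A rule: infinite_finite_induct)
      (simp_all add: linear_on_poly_0[OF lin] linear_on_poly_add[OF lin])
  have "\<Phi> p = \<Phi> (\<Sum>k\<le>degree p. smult (coeff p k) (monom 1 k))"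
    by (simp add: smult_monom poly_as_sum_of_monoms)
  then show ?thesis
    unfolding sum coeff_pairing_def by (simp only: linear_on_poly_smult[OF lin])
qed

lemma coeff_pairing_mult_X: "coeff_pairing f ([:0, 1:] * p) = coeff_pairing (\<lambda>k. f (Suc k)) p"
proof -
  have "coeff_pairing f ([:0, 1:] * p) = coeff_pairing (\<lambda>k. coeff_pairing f ([:0, 1:] * monom 1 k)) p"
    by (rule linear_on_poly_eq_coeff_pairing[OF linear_on_poly_comp_mult[OF linear_coeff_pairing]])
  then show ?thesis by (simp add: coeff_pairing_monom monom_Suc[symmetric])
qed

text \<open>If the sequence \<open>f\<close> satisfies the linear recurrence with characteristic polynomial \<open>q\<close>, then the
functional vanishes on the ideal \<open>(q)\<close>.\<close>

lemma coeff_pairing_mult_eq_0: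
  assumes rec: "\<And>n. coeff_pairing (\<lambda>k. f (k + n)) q = 0"
  shows "coeff_pairing f (q * p) = 0"
proof -
  have *: "coeff_pairing f (q * monom 1 n) = 0" for n
  proof -
    have "coeff_pairing f (monom 1 n * q) = coeff_pairing (\<lambda>k. coeff_pairing f (monom 1 n * monom 1 k)) q"
      by (rule linear_on_poly_eq_coeff_pairing[OF linear_on_poly_comp_mult[OF linear_coeff_pairing]])
    then show ?thesis by (simp add: mult_monom coeff_pairing_monom rec mult.commute add.commute)
  qed
  have "coeff_pairing f (q * p) = coeff_pairing (\<lambda>k. coeff_pairing f (q * monom 1 k)) p"
    by (rule linear_on_poly_eq_coeff_pairing[OF linear_on_poly_comp_mult[OF linear_coeff_pairing]])
  also have "\<dots> = 0" unfolding * by (simp add: coeff_pairing_def)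
  finally show ?thesis .
qed

lemma linear_on_poly_coeff_pairing_param:
  assumes "\<And>a. linear_on_poly (\<Psi> a)"
  shows "linear_on_poly (\<lambda>q. coeff_pairing (\<lambda>a. \<Psi> a q) p)"
  using assms unfolding linear_on_poly_def coeff_pairing_def
  by (simp add: sum.distrib sum_distrib_left algebra_simps)

lemma coeff_pairing_swap:
  "coeff_pairing (\<lambda>a. coeff_pairing (\<lambda>b. f a b) q) p = coeff_pairing (\<lambda>b. coeff_pairing (\<lambda>a. f a b) p) q"
proof -
  have "coeff_pairing (\<lambda>a. coeff_pairing (\<lambda>b. f a b) q) p =
      (\<Sum>a\<le>degree p. \<Sum>b\<le>degree q. coeff p a * (coeff q b * f a b))"
    unfolding coeff_pairing_def by (simp add: sum_distrib_left)
  also have "\<dots> = (\<Sum>b\<le>degree q. \<Sum>a\<le>degree p. coeff p a * (coeff q b * f a b))"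
    by (rule sum.swap)
  also have "\<dots> = coeff_pairing (\<lambda>b. coeff_pairing (\<lambda>a. f a b) p) q"
    unfolding coeff_pairing_def by (simp add: sum_distrib_left mult.left_commute)
  finally show ?thesis .
qed

lemma coeff_pairing_zero_fun: "coeff_pairing (\<lambda>_. 0) p = 0"
  by (simp add: coeff_pairing_def)

lemma coeff_pairing_minus_fun: "coeff_pairing (\<lambda>a. - f a) p = - coeff_pairing f p"
  by (simp add: coeff_pairing_def sum_negf)

text \<open>The trilinear form on \<open>C[t]\<close> with \<open>(t\<^sup>a, t\<^sup>b, t\<^sup>c) \<mapsto> f a b c\<close>.\<close>

definition coeff_pairing3 ::
  "(nat \<Rightarrow> nat \<Rightarrow> nat \<Rightarrow> complex) \<Rightarrow> complex poly \<Rightarrow> complex poly \<Rightarrow> complex poly \<Rightarrow> complex" where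
  "coeff_pairing3 f P Q R = coeff_pairing (\<lambda>a. coeff_pairing (\<lambda>b. coeff_pairing (\<lambda>c. f a b c) R) Q) P"

lemma trilinear_coeff_pairing3: "trilinear_on_poly (coeff_pairing3 f)"
proof -
  have "linear_on_poly (\<lambda>P. coeff_pairing3 f P Q R)" for Q R
    unfolding coeff_pairing3_def by (rule linear_coeff_pairing)
  moreover have "linear_on_poly (\<lambda>Q. coeff_pairing3 f P Q R)" for P R
    unfolding coeff_pairing3_def
    by (rule linear_on_poly_coeff_pairing_param) (rule linear_coeff_pairing)
  moreover have "linear_on_poly (\<lambda>R. coeff_pairing3 f P Q R)" for P Q
    unfolding coeff_pairing3_def
    by (rule linear_on_poly_coeff_pairing_param, rule linear_on_poly_coeff_pairing_param)
      (rule linear_coeff_pairing)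
  ultimately show ?thesis unfolding trilinear_on_poly_def by blast
qed

lemma coeff_pairing3_swap12: "coeff_pairing3 f P Q R = coeff_pairing3 (\<lambda>a b c. f b a c) Q P R"
  unfolding coeff_pairing3_def by (rule coeff_pairing_swap)

lemma coeff_pairing3_swap23: "coeff_pairing3 f P Q R = coeff_pairing3 (\<lambda>a b c. f a c b) P R Q"
  unfolding coeff_pairing3_def by (subst coeff_pairing_swap) (rule refl)

lemma coeff_pairing3_minus: "coeff_pairing3 (\<lambda>a b c. - f a b c) P Q R = - coeff_pairing3 f P Q R"
  unfolding coeff_pairing3_def coeff_pairing_minus_fun ..

lemma coeff_pairing3_mult_X:
  "coeff_pairing3 f ([:0, 1:] * P) ([:0, 1:] * Q) ([:0, 1:] * R) =
    coeff_pairing3 (\<lambda>a b c. f (Suc a) (Suc b) (Suc c)) P Q R"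
  unfolding coeff_pairing3_def coeff_pairing_mult_X ..

lemma coeff_pairing3_ann1:
  assumes "\<And>n b c. coeff_pairing (\<lambda>k. f (k + n) b c) q = 0"
  shows "coeff_pairing3 f (q * P) Q R = 0"
  unfolding coeff_pairing3_def
proof (rule coeff_pairing_mult_eq_0)
  fix n
  have "coeff_pairing (\<lambda>k. coeff_pairing (\<lambda>b. coeff_pairing (\<lambda>c. f (k + n) b c) R) Q) q =
      coeff_pairing3 (\<lambda>k b c. f (k + n) b c) q Q R" by (simp add: coeff_pairing3_def)
  also have "\<dots> = coeff_pairing3 (\<lambda>b c k. f (k + n) b c) Q R q"
    by (subst coeff_pairing3_swap12, subst coeff_pairing3_swap23) (rule refl)
  also have "\<dots> = 0" using assms by (simp add: coeff_pairing3_def coeff_pairing_zero_fun)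
  finally show "coeff_pairing (\<lambda>k. coeff_pairing (\<lambda>b. coeff_pairing (\<lambda>c. f (k + n) b c) R) Q) q = 0" .
qed

lemma coeff_pairing3_ann2:
  assumes "\<And>n a c. coeff_pairing (\<lambda>k. f a (k + n) c) q = 0"
  shows "coeff_pairing3 f P (q * Q) R = 0"
  by (subst coeff_pairing3_swap12) (rule coeff_pairing3_ann1, rule assms)

lemma coeff_pairing3_ann3:
  assumes "\<And>n a b. coeff_pairing (\<lambda>k. f a b (k + n)) q = 0"
  shows "coeff_pairing3 f P Q (q * R) = 0"
  by (subst coeff_pairing3_swap23) (rule coeff_pairing3_ann2, rule assms)

section \<open>Alternating invariant forms on polynomials\<close>

text \<open>The polynomial core of the existence of roots. If two or three slots carry the same index and the same
root, then the form restricted to primary components is skew in these slots, because the cofactor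
\<open>e l z\<close> is the same in all of them; so the primary component has dimension \<open>m l\<close> at least the number
of these slots.\<close>

lemma admissible_roots:
  fixes f :: "nat \<Rightarrow> nat \<Rightarrow> nat \<Rightarrow> complex" and \<delta> :: "nat \<Rightarrow> complex poly"
  assumes ann1: "\<And>n b c. coeff_pairing (\<lambda>k. f (k + n) b c) (\<delta> i1) = 0"
    and ann2: "\<And>n a c. coeff_pairing (\<lambda>k. f a (k + n) c) (\<delta> i2) = 0"
    and ann3: "\<And>n a b. coeff_pairing (\<lambda>k. f a b (k + n)) (\<delta> i3) = 0"
    and inv: "\<And>a b c. f (Suc a) (Suc b) (Suc c) = f a b c"
    and skew12: "\<And>a b c. i1 = i2 \<Longrightarrow> f b a c = - f a b c"
    and skew13: "\<And>a b c. i1 = i3 \<Longrightarrow> f c b a = - f a b c"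
    and skew23: "\<And>a b c. i2 = i3 \<Longrightarrow> f a c b = - f a b c"
    and e: "\<And>l z. l \<in> {i1, i2, i3} \<Longrightarrow> poly (\<delta> l) z = 0 \<Longrightarrow>
      \<delta> l = [:-z, 1:] ^ m l * e l z \<and> poly (e l z) z \<noteq> 0"
    and nz: "f a0 b0 c0 \<noteq> 0"
  obtains z1 z2 z3 where "poly (\<delta> i1) z1 = 0" "poly (\<delta> i2) z2 = 0" "poly (\<delta> i3) z3 = 0"
    "z1 * z2 * z3 = 1"
    "i1 = i2 \<and> z1 = z2 \<longrightarrow> m i1 \<ge> 2" "i1 = i3 \<and> z1 = z3 \<longrightarrow> m i1 \<ge> 2" "i2 = i3 \<and> z2 = z3 \<longrightarrow> m i2 \<ge> 2"
    "i1 = i2 \<and> z1 = z2 \<and> i1 = i3 \<and> z1 = z3 \<longrightarrow> m i1 \<ge> 3"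
proof -
  define T where "T = coeff_pairing3 f"
  have tri: "trilinear_on_poly T" unfolding T_def by (rule trilinear_coeff_pairing3)
  have sk12: "T P Q R = - T Q P R" if "i1 = i2" for P Q R
  proof -
    have "(\<lambda>a b c. f b a c) = (\<lambda>a b c. - f a b c)" by (intro ext) (rule skew12[OF that])
    then show ?thesis
      unfolding T_def by (subst coeff_pairing3_swap12) (simp only: coeff_pairing3_minus)
  qed
  have sk23: "T P Q R = - T P R Q" if "i2 = i3" for P Q R
  proof -
    have "(\<lambda>a b c. f a c b) = (\<lambda>a b c. - f a b c)" by (intro ext) (rule skew23[OF that])
    then show ?thesis
      unfolding T_def by (subst coeff_pairing3_swap23) (simp only: coeff_pairing3_minus)
  qed
  have sk13: "T P Q R = - T R Q P" if "i1 = i3" for P Q R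
  proof -
    have "T P Q R = coeff_pairing3 (\<lambda>a b c. f c b a) R Q P"
      unfolding T_def by (subst coeff_pairing3_swap12, subst coeff_pairing3_swap23,
          subst coeff_pairing3_swap12) (rule refl)
    moreover have "(\<lambda>a b c. f c b a) = (\<lambda>a b c. - f a b c)" by (intro ext) (rule skew13[OF that])
    ultimately show ?thesis unfolding T_def by (simp only: coeff_pairing3_minus)
  qed
  have T1: "T (\<delta> i1 * P) Q R = 0" for P Q R unfolding T_def by (rule coeff_pairing3_ann1[OF ann1])
  have T2: "T P (\<delta> i2 * Q) R = 0" for P Q R unfolding T_def by (rule coeff_pairing3_ann2[OF ann2])
  have T3: "T P Q (\<delta> i3 * R) = 0" for P Q R unfolding T_def by (rule coeff_pairing3_ann3[OF ann3])
  have Tinv: "T ([:0, 1:] * P) ([:0, 1:] * Q) ([:0, 1:] * R) = T P Q R" for P Q R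
    unfolding T_def coeff_pairing3_mult_X inv ..
  have Tnz: "T (monom 1 a0) (monom 1 b0) (monom 1 c0) \<noteq> 0"
    using nz by (simp add: T_def coeff_pairing3_def coeff_pairing_monom)
  have e1: "poly (\<delta> i1) z = 0 \<Longrightarrow> \<delta> i1 = [:-z, 1:] ^ m i1 * e i1 z \<and> poly (e i1 z) z \<noteq> 0"
    and e2: "poly (\<delta> i2) z = 0 \<Longrightarrow> \<delta> i2 = [:-z, 1:] ^ m i2 * e i2 z \<and> poly (e i2 z) z \<noteq> 0"
    and e3: "poly (\<delta> i3) z = 0 \<Longrightarrow> \<delta> i3 = [:-z, 1:] ^ m i3 * e i3 z \<and> poly (e i3 z) z \<noteq> 0" for z
    using e by blast+
  obtain z1 z2 z3 P Q R where z: "poly (\<delta> i1) z1 = 0" "poly (\<delta> i2) z2 = 0" "poly (\<delta> i3) z3 = 0"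
    and prod: "z1 * z2 * z3 = 1" and PQR: "T (e i1 z1 * P) (e i2 z2 * Q) (e i3 z3 * R) \<noteq> 0"
    using common_point[OF tri Tinv T1 T2 T3 e1 e2 e3 Tnz] by blast
  define W where "W P Q R = T (e i1 z1 * P) (e i2 z2 * Q) (e i3 z3 * R)" for P Q R
  have triW: "trilinear_on_poly W" unfolding W_def by (rule trilinear_on_poly_comp_mult[OF tri])
  note lin = trilinear_on_poly_lin[OF triW]
  have eq1: "e i1 z1 * ([:-z1, 1:] ^ m i1 * P) = \<delta> i1 * P" for P
    using e1[OF z(1)] by (simp only: mult_ac)
  have eq2: "e i2 z2 * ([:-z2, 1:] ^ m i2 * P) = \<delta> i2 * P" for P
    using e2[OF z(2)] by (simp only: mult_ac)
  have W1: "W ([:-z1, 1:] ^ m i1 * P) Q R = 0" for P Q R unfolding W_def eq1 by (rule T1)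
  have W2: "W P ([:-z2, 1:] ^ m i2 * Q) R = 0" for P Q R unfolding W_def eq2 by (rule T2)
  have Wnz: "W P Q R \<noteq> 0" using PQR unfolding W_def .
  \<comment> \<open>a root of \<open>\<delta>\<close> cannot be a root of the cofactor, so the exponent is positive\<close>
  have pos: "m i1 > 0" "m i2 > 0"
    using e1[OF z(1)] z(1) e2[OF z(2)] z(2) by (auto intro!: Nat.gr0I)
  have skW12: "W P Q R = - W Q P R" if "i1 = i2" "z1 = z2" for P Q R
    using sk12[OF that(1), of "e i1 z1 * P" "e i2 z2 * Q"] that by (simp add: W_def)
  have skW13: "W P Q R = - W R Q P" if "i1 = i3" "z1 = z3" for P Q R
    using sk13[OF that(1), of "e i1 z1 * P" _ "e i3 z3 * R"] that by (simp add: W_def)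
  have skW23: "W P Q R = - W P R Q" if "i2 = i3" "z2 = z3" for P Q R
    using sk23[OF that(1), of _ "e i2 z2 * Q" "e i3 z3 * R"] that by (simp add: W_def)
  have c12: "m i1 \<ge> 2" if "i1 = i2" "z1 = z2"
  proof (rule ccontr)
    assume "\<not> m i1 \<ge> 2"
    then have "m i1 = 1" using pos by simp
    then have ann: "W ([:-z1, 1:] * P) Q R = 0" for P Q R using W1 by simp
    have "W P Q R = 0"
      by (rule skew_bilinear_eq_0[of "\<lambda>P Q. W P Q R", OF lin(1) lin(2) _ ann])
        (rule skW12[OF that])
    then show False using Wnz by simp
  qed
  have c13: "m i1 \<ge> 2" if "i1 = i3" "z1 = z3"
  proof (rule ccontr)
    assume "\<not> m i1 \<ge> 2"
    then have "m i1 = 1" using pos by simp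
    then have ann: "W ([:-z1, 1:] * P) Q R = 0" for P Q R using W1 by simp
    have "W P Q R = 0"
      by (rule skew_bilinear_eq_0[of "\<lambda>P R. W P Q R", OF lin(1) lin(3) _ ann])
        (rule skW13[OF that])
    then show False using Wnz by simp
  qed
  have c23: "m i2 \<ge> 2" if "i2 = i3" "z2 = z3"
  proof (rule ccontr)
    assume "\<not> m i2 \<ge> 2"
    then have "m i2 = 1" using pos by simp
    then have ann: "W P ([:-z2, 1:] * Q) R = 0" for P Q R using W2 by simp
    have "W P Q R = 0"
      by (rule skew_bilinear_eq_0[of "\<lambda>Q R. W P Q R", OF lin(2) lin(3) _ ann])
        (rule skW23[OF that])
    then show False using Wnz by simp
  qed
  have c123: "m i1 \<ge> 3" if "i1 = i2" "z1 = z2" "i1 = i3" "z1 = z3"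
  proof (rule ccontr)
    assume "\<not> m i1 \<ge> 3"
    then have "m i1 = 2" using c12 that by simp
    then have ann: "W ([:-z1, 1:] ^ 2 * P) Q R = 0" for P Q R using W1 by simp
    have "W P Q R = 0"
    proof (rule skew_trilinear_eq_0[OF triW _ _ ann])
      show "W P Q R = - W Q P R" for P Q R by (rule skW12[OF that(1,2)])
      show "W P Q R = - W P R Q" for P Q R using that by (intro skW23) simp_all
    qed
    then show False using Wnz by simp
  qed
  show ?thesis using that[OF z prod] c12 c13 c23 c123 by blast
qed

section \<open>Roots of powers of prime polynomials\<close>

lemma map_poly_of_rat_mult:
  "map_poly (of_rat :: rat \<Rightarrow> complex) (p * q) = map_poly of_rat p * map_poly of_rat q"
  by (rule poly_eqI) (simp add: coeff_map_poly coeff_mult of_rat_sum of_rat_mult)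

lemma map_poly_of_rat_power:
  "map_poly (of_rat :: rat \<Rightarrow> complex) (p ^ n) = map_poly of_rat p ^ n"
  by (induction n) (simp_all add: map_poly_of_rat_mult)

lemma map_poly_of_rat_add:
  "map_poly (of_rat :: rat \<Rightarrow> complex) (p + q) = map_poly of_rat p + map_poly of_rat q"
  by (rule poly_eqI) (simp add: coeff_map_poly of_rat_add)

lemma map_poly_of_rat_pderiv:
  "map_poly (of_rat :: rat \<Rightarrow> complex) (pderiv p) = pderiv (map_poly of_rat p)"
  by (rule poly_eqI) (simp add: coeff_map_poly coeff_pderiv of_rat_mult of_rat_add)

text \<open>A prime polynomial over the rationals is coprime to its derivative.\<close>

lemma prime_elem_root_simple:
  fixes \<pi> :: "rat poly"
  assumes pr: "prime_elem \<pi>" and root: "poly (map_poly of_rat \<pi>) (z :: complex) = 0"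
  shows "poly (pderiv (map_poly of_rat \<pi>)) z \<noteq> 0"
proof -
  have "degree \<pi> \<noteq> 0"
    using pr by (metis prime_elem_def is_unit_iff_degree)
  then have nz: "pderiv \<pi> \<noteq> 0" by (simp add: pderiv_eq_0_iff)
  have "\<not> \<pi> dvd pderiv \<pi>"
    using dvd_imp_degree_le[OF _ nz, of \<pi>] \<open>degree \<pi> \<noteq> 0\<close> by (auto simp: degree_pderiv)
  then have "coprime \<pi> (pderiv \<pi>)" by (rule prime_elem_imp_coprime[OF pr])
  then have gcd: "gcd \<pi> (pderiv \<pi>) = 1" unfolding coprime_iff_gcd_eq_1 .
  define u v where "u = fst (bezout_coefficients \<pi> (pderiv \<pi>))"
    and "v = snd (bezout_coefficients \<pi> (pderiv \<pi>))"
  have "u * \<pi> + v * pderiv \<pi> = 1"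
    unfolding u_def v_def gcd[symmetric] by (rule bezout_coefficients_fst_snd)
  then have "map_poly of_rat (u * \<pi> + v * pderiv \<pi>) = (1 :: complex poly)" by simp
  then have "map_poly of_rat u * map_poly of_rat \<pi> + map_poly of_rat v * pderiv (map_poly of_rat \<pi>) =
      (1 :: complex poly)"
    by (simp only: map_poly_of_rat_add map_poly_of_rat_mult map_poly_of_rat_pderiv)
  then have "poly (map_poly of_rat u * map_poly of_rat \<pi> + map_poly of_rat v * pderiv (map_poly of_rat \<pi>)) z = 1"
    by simp
  then show ?thesis using root by auto
qed

lemma prime_power_root_multiplicity:
  fixes \<pi> :: "rat poly"
  assumes pr: "prime_elem \<pi>" and root: "poly (map_poly of_rat (\<pi> ^ m)) (z :: complex) = 0"
  shows "\<exists>e. map_poly of_rat (\<pi> ^ m) = [:-z, 1:] ^ m * e \<and> poly e z \<noteq> 0"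
proof -
  let ?p = "map_poly of_rat \<pi> :: complex poly"
  have "poly ?p z = 0" using root by (simp add: map_poly_of_rat_power)
  moreover from this obtain g where g: "?p = [:-z, 1:] * g" by (metis poly_eq_0_iff_dvd dvdE)
  ultimately have "poly g z \<noteq> 0"
    using prime_elem_root_simple[OF pr, of z] unfolding g pderiv_mult by (auto simp: pderiv_pCons)
  then show ?thesis
    unfolding map_poly_of_rat_power g power_mult_distrib by (intro exI[of _ "g ^ m"]) simp
qed

section \<open>Forms on the space H\<close>

text \<open>The rational-linear map from a free rational vector space to the complex numbers with values \<open>f\<close> on
the basis.\<close>

definition rat_extension :: "('k \<Rightarrow> complex) \<Rightarrow> ('k \<Rightarrow>\<^sub>0 rat) \<Rightarrow> complex" where
  "rat_extension f v = (\<Sum>k\<in>Poly_Mapping.keys v. of_rat (Poly_Mapping.lookup v k) * f k)"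

lemma rat_extension_superset:
  assumes "finite A" "Poly_Mapping.keys v \<subseteq> A"
  shows "rat_extension f v = (\<Sum>k\<in>A. of_rat (Poly_Mapping.lookup v k) * f k)"
  unfolding rat_extension_def using assms by (intro sum.mono_neutral_left) (auto simp: in_keys_iff)

lemma rat_extension_add: "rat_extension f (v + w) = rat_extension f v + rat_extension f w"
proof -
  let ?A = "Poly_Mapping.keys v \<union> Poly_Mapping.keys w"
  have "rat_extension f (v + w) = (\<Sum>k\<in>?A. of_rat (Poly_Mapping.lookup (v + w) k) * f k)"
    by (rule rat_extension_superset) (simp_all add: Poly_Mapping.keys_add)
  then show ?thesis
    using rat_extension_superset[of ?A v f] rat_extension_superset[of ?A w f]
    by (simp add: lookup_add of_rat_add distrib_right sum.distrib)
qed

lemma rat_extension_single: "rat_extension f (Poly_Mapping.single k c) = of_rat c * f k"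
  using rat_extension_superset[of "{k}" "Poly_Mapping.single k c" f] by simp

lemma rat_extension_rat_scale: "rat_extension f (rat_scale c v) = of_rat c * rat_extension f v"
proof -
  have "rat_extension f (rat_scale c v) =
      (\<Sum>k\<in>Poly_Mapping.keys v. of_rat (Poly_Mapping.lookup (rat_scale c v) k) * f k)"
    by (rule rat_extension_superset) (auto simp: in_keys_iff)
  then show ?thesis
    by (simp add: rat_extension_def of_rat_mult sum_distrib_left mult.assoc)
qed

lemma rat_extension_diff: "rat_extension f (v - w) = rat_extension f v - rat_extension f w"
  using rat_extension_add[of f "v - w" w] by simp

lemma vector_space_complex_over_rat: "vector_space (\<lambda>(q::rat) (c::complex). of_rat q * c)"
  by unfold_locales (simp_all add: of_rat_add of_rat_mult algebra_simps)

text \<open>The action of \<open>t\<close>.\<close>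

abbreviation t_mult :: "(laurent \<Rightarrow> 'a \<Rightarrow> 'a) \<Rightarrow> 'a \<Rightarrow> 'a" where
  "t_mult act \<equiv> act (Poly_Mapping.single 1 1)"

text \<open>The complex-valued rational-linear forms on \<open>H\<close>, described as alternating rational-trilinear forms
\<open>F\<close> on the module with \<open>F(tx, ty, tz) = F(x, y, z)\<close>.\<close>

definition invariant_form ::
  "(laurent \<Rightarrow> 'a::ab_group_add \<Rightarrow> 'a) \<Rightarrow> ('a \<Rightarrow> 'a \<Rightarrow> 'a \<Rightarrow> complex) \<Rightarrow> bool" where
  "invariant_form act F \<longleftrightarrow>
     (\<forall>x x' y z. F (x + x') y z = F x y z + F x' y z) \<and>
     (\<forall>x y y' z. F x (y + y') z = F x y z + F x y' z) \<and>
     (\<forall>x y z z'. F x y (z + z') = F x y z + F x y z') \<and>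
     (\<forall>c x y z. F (act (Poly_Mapping.single 0 c) x) y z = of_rat c * F x y z) \<and>
     (\<forall>c x y z. F x (act (Poly_Mapping.single 0 c) y) z = of_rat c * F x y z) \<and>
     (\<forall>c x y z. F x y (act (Poly_Mapping.single 0 c) z) = of_rat c * F x y z) \<and>
     (\<forall>x y. F x x y = 0) \<and> (\<forall>x y. F x y x = 0) \<and> (\<forall>x y. F y x x = 0) \<and>
     (\<forall>x y z. F (t_mult act x) (t_mult act y) (t_mult act z) = F x y z)"

text \<open>Generators of the kernel of the map from the free space on triples onto \<open>H\<close>.\<close>

definition H_relators :: "(laurent \<Rightarrow> 'a::ab_group_add \<Rightarrow> 'a) \<Rightarrow> 'a triples set" where
  "H_relators act = wedge_relators act \<union>
     {triple x y z - triple (t_mult act x) (t_mult act y) (t_mult act z) | x y z. True}"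

text \<open>A vector outside a subspace is separated from it by a linear functional, here with complex values.\<close>

lemma separating_functional:
  assumes v: "v \<notin> rat_span (H_relators act)"
  obtains G where "\<And>u w. G (u + w) = G u + G w" "\<And>c w. G (rat_scale c w) = of_rat c * G w"
    "\<And>w. w \<in> H_relators act \<Longrightarrow> G w = (0::complex)" "G v \<noteq> 0"
proof -
  interpret V: vector_space "rat_scale :: rat \<Rightarrow> 'a triples \<Rightarrow> 'a triples"
    by (rule vector_space_rat_scale)
  interpret C: vector_space "\<lambda>(q::rat) (c::complex). of_rat q * c"
    by (rule vector_space_complex_over_rat)
  interpret P: vector_space_pair "rat_scale :: rat \<Rightarrow> 'a triples \<Rightarrow> 'a triples"
      "\<lambda>(q::rat) (c::complex). of_rat q * c" ..
  obtain B where B: "B \<subseteq> H_relators act" "V.independent B" "H_relators act \<subseteq> V.span B"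
    using V.maximal_independent_subset by blast
  have "V.span B = V.span (H_relators act)"
    using B by (meson V.span_eq V.span_superset order_trans)
  then have vB: "v \<notin> V.span B" using v by simp
  then have "V.independent (insert v B)" using B(2) by (rule V.independent_insertI)
  then obtain G where G: "\<forall>x\<in>insert v B. G x = (if x = v then 1 else 0)"
    and lin: "Vector_Spaces.linear rat_scale (\<lambda>(q::rat) (c::complex). of_rat q * c) G"
    using P.linear_independent_extend[of "insert v B" "\<lambda>x. if x = v then 1 else 0"] by blast
  interpret G: Vector_Spaces.linear "rat_scale :: rat \<Rightarrow> 'a triples \<Rightarrow> 'a triples"
      "\<lambda>(q::rat) (c::complex). of_rat q * c" G by (rule lin)
  have "v \<notin> B" using vB V.span_base by blast
  then have "G w = 0" if "w \<in> B" for w using G that by auto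
  then have "G w = 0" if "w \<in> H_relators act" for w
    using G.eq_0_on_span[of B w] B(3) that by blast
  then show ?thesis using that[of G] G.add G.scale G by auto
qed

lemma not_in_span_iff_form:
  "triple x y z \<notin> rat_span (H_relators act) \<longleftrightarrow> (\<exists>F. invariant_form act F \<and> F x y z \<noteq> 0)"
proof
  assume "triple x y z \<notin> rat_span (H_relators act)"
  then obtain G where add: "\<And>u w. G (u + w) = G u + G w"
    and scale: "\<And>c w. G (rat_scale c w) = of_rat c * G w"
    and zero: "\<And>w. w \<in> H_relators act \<Longrightarrow> G w = (0::complex)" and nz: "G (triple x y z) \<noteq> 0"
    using separating_functional by metis
  have diff: "G (u - w) = G u - G w" for u w using add[of "u - w" w] by simp
  have wedge: "G w = 0" if "w \<in> wedge_relators act" for w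
    using zero that by (simp add: H_relators_def)
  have inv: "G (triple x y z) - G (triple (t_mult act x) (t_mult act y) (t_mult act z)) = 0" for x y z
    unfolding diff[symmetric] by (rule zero) (auto simp: H_relators_def)
  note rels = wedge_relators.intros[where act = act, THEN wedge, unfolded diff scale]
  have "invariant_form act (\<lambda>x y z. G (triple x y z))"
    unfolding invariant_form_def
    using rels inv by (simp add: algebra_simps)
  then show "\<exists>F. invariant_form act F \<and> F x y z \<noteq> 0" using nz by blast
next
  assume "\<exists>F. invariant_form act F \<and> F x y z \<noteq> 0"
  then obtain F where F: "invariant_form act F" and nz: "F x y z \<noteq> 0" by blast
  define G where "G = rat_extension (\<lambda>(x, y, z). F x y z)"
  have tr: "G (triple x y z) = F x y z" for x y z
    by (simp add: G_def triple_def rat_extension_single)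
  have diff: "G (v - w) = G v - G w" for v w unfolding G_def by (rule rat_extension_diff)
  have scale: "G (rat_scale c v) = of_rat c * G v" for c v
    unfolding G_def by (rule rat_extension_rat_scale)
  have rel: "G w = 0" if "w \<in> H_relators act" for w
    using that unfolding H_relators_def
  proof (elim UnE CollectE exE conjE)
    assume "w \<in> wedge_relators act"
    then show ?thesis
      using F unfolding invariant_form_def by cases (simp_all add: diff scale tr)
  next
    fix x y z
    assume "w = triple x y z - triple (t_mult act x) (t_mult act y) (t_mult act z)"
    then show ?thesis using F unfolding invariant_form_def by (simp add: diff tr)
  qed
  interpret V: vector_space "rat_scale :: rat \<Rightarrow> 'a triples \<Rightarrow> 'a triples"
    by (rule vector_space_rat_scale)
  interpret C: vector_space "\<lambda>(q::rat) (c::complex). of_rat q * c"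
    by (rule vector_space_complex_over_rat)
  interpret G: module_hom "rat_scale :: rat \<Rightarrow> 'a triples \<Rightarrow> 'a triples"
      "\<lambda>(q::rat) (c::complex). of_rat q * c" G
    by unfold_locales (simp_all add: G_def rat_extension_add rat_extension_rat_scale)
  have "G w = 0" if "w \<in> rat_span (H_relators act)" for w
    using G.eq_0_on_span[OF rel that] .
  then show "triple x y z \<notin> rat_span (H_relators act)" using nz tr by metis
qed

lemma comm_group_additive_group: "comm_group (additive_group (UNIV :: 'v::ab_group_add set))"
proof (rule comm_groupI)
  fix x :: 'v
  have "- x + x = 0" by simp
  then show "\<exists>y\<in>carrier (additive_group UNIV).
      y \<otimes>\<^bsub>additive_group UNIV\<^esub> x = \<one>\<^bsub>additive_group UNIV\<^esub>"
    unfolding additive_group_def by (metis UNIV_I monoid.simps partial_object.simps(1))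
qed (simp_all add: additive_group_def add.assoc add.commute)

lemma subgroup_rat_span:
  fixes S :: "('k \<Rightarrow>\<^sub>0 rat) set"
  shows "subgroup (rat_span S) (additive_group UNIV)"
proof -
  interpret V: vector_space "rat_scale :: rat \<Rightarrow> ('k \<Rightarrow>\<^sub>0 rat) \<Rightarrow> ('k \<Rightarrow>\<^sub>0 rat)"
    by (rule vector_space_rat_scale)
  interpret G: comm_group "additive_group (UNIV :: ('k \<Rightarrow>\<^sub>0 rat) set)"
    by (rule comm_group_additive_group)
  have inv: "inv\<^bsub>additive_group UNIV\<^esub> x = - x" for x :: "'k \<Rightarrow>\<^sub>0 rat"
    by (rule G.inv_equality) (simp_all add: additive_group_def)
  show ?thesis
  proof (rule G.subgroupI)
    fix a assume "a \<in> rat_span S" then show "inv\<^bsub>additive_group UNIV\<^esub> a \<in> rat_span S"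
      unfolding inv by (rule V.span_neg)
  next
    fix a b assume "a \<in> rat_span S" "b \<in> rat_span S"
    then show "a \<otimes>\<^bsub>additive_group UNIV\<^esub> b \<in> rat_span S"
      by (simp add: additive_group_def V.span_add)
  qed (use V.span_zero in \<open>auto simp: additive_group_def\<close>)
qed

text \<open>\<open>H\<close> is a quotient of a quotient; its zero elements are the classes of the vectors in the span of both
families of relators.\<close>

lemma H_class_eq_one_iff:
  "H_class act v = \<one>\<^bsub>H_space act\<^esub> \<longleftrightarrow> v \<in> rat_span (H_relators act)"
proof -
  let ?G = "additive_group (UNIV :: 'a triples set)"
  let ?N = "rat_span (wedge_relators act)"
  let ?S = "{triple x y z - triple (t_mult act x) (t_mult act y) (t_mult act z) | x y z. True}"
  interpret V: vector_space "rat_scale :: rat \<Rightarrow> 'a triples \<Rightarrow> 'a triples"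
    by (rule vector_space_rat_scale)
  interpret G: comm_group ?G by (rule comm_group_additive_group)
  interpret N: normal ?N ?G by (rule G.subgroup_imp_normal[OF subgroup_rat_span])
  interpret L: group "Lambda3 act" unfolding Lambda3_def by (rule N.factorgroup_is_group)
  have carr: "carrier ?G = UNIV" by (simp add: additive_group_def)
  have hom: "Lambda3_class act \<in> hom ?G (Lambda3 act)"
    using N.r_coset_hom_Mod unfolding Lambda3_def Lambda3_class_def by (simp add: carr)
  interpret h: group_hom ?G "Lambda3 act" "Lambda3_class act"
    by unfold_locales (rule hom)
  have trel: "t_relations act = Lambda3_class act ` rat_span ?S"
    by (simp add: t_relations_def Let_def)
  have sub: "subgroup (t_relations act) (Lambda3 act)"
    unfolding trel by (rule h.subgroup_img_is_subgroup[OF subgroup_rat_span])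
  have carrv: "Lambda3_class act v \<in> carrier (Lambda3 act)" using h.hom_closed by (simp add: carr)
  have one: "\<one>\<^bsub>H_space act\<^esub> = t_relations act" by (simp add: H_space_def FactGroup_def)
  have "H_class act v = \<one>\<^bsub>H_space act\<^esub> \<longleftrightarrow> Lambda3_class act v \<in> t_relations act"
    unfolding H_class_def one using L.coset_join1[OF _ carrv sub] L.coset_join2[OF carrv sub]
      subgroup.subset[OF sub] by blast
  also have "\<dots> \<longleftrightarrow> (\<exists>s\<in>rat_span ?S. Lambda3_class act v = Lambda3_class act s)"
    unfolding trel by blast
  also have "\<dots> \<longleftrightarrow> (\<exists>s\<in>rat_span ?S. v - s \<in> ?N)"
  proof (rule bex_cong[OF refl])
    fix s
    have "Lambda3_class act v = Lambda3_class act s \<longleftrightarrow> (\<lambda>n. n + v) ` ?N = (\<lambda>n. n + s) ` ?N"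
      by (simp add: Lambda3_class_def r_coset_def additive_group_def UNION_singleton_eq_range)
    also have "\<dots> \<longleftrightarrow> v - s \<in> ?N"
    proof
      assume "(\<lambda>n. n + v) ` ?N = (\<lambda>n. n + s) ` ?N"
      then have "0 + v \<in> (\<lambda>n. n + s) ` ?N" using V.span_zero by blast
      then show "v - s \<in> ?N" by auto
    next
      assume *: "v - s \<in> ?N"
      show "(\<lambda>n. n + v) ` ?N = (\<lambda>n. n + s) ` ?N"
      proof (intro equalityI image_subsetI)
        fix n assume "n \<in> ?N"
        then have "n + (v - s) \<in> ?N" "n - (v - s) \<in> ?N"
          using * V.span_add V.span_diff by blast+
        moreover have "n + v = (n + (v - s)) + s" "n + s = (n - (v - s)) + v" by simp_all
        ultimately show "n + v \<in> (\<lambda>n. n + s) ` ?N" "n + s \<in> (\<lambda>n. n + v) ` ?N" by blast+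
      qed
    qed
    finally show "Lambda3_class act v = Lambda3_class act s \<longleftrightarrow> v - s \<in> ?N" .
  qed
  also have "\<dots> \<longleftrightarrow> v \<in> rat_span (H_relators act)"
    unfolding H_relators_def V.span_Un
  proof
    assume "\<exists>s\<in>rat_span ?S. v - s \<in> ?N"
    then obtain s where "s \<in> rat_span ?S" "v - s \<in> ?N" by blast
    then show "v \<in> {x + y |x y. x \<in> ?N \<and> y \<in> rat_span ?S}"
      by (intro CollectI exI[of _ "v - s"] exI[of _ s]) simp
  next
    assume "v \<in> {x + y |x y. x \<in> ?N \<and> y \<in> rat_span ?S}"
    then obtain x y where "v = x + y" "x \<in> ?N" "y \<in> rat_span ?S" by blast
    then show "\<exists>s\<in>rat_span ?S. v - s \<in> ?N" by (intro bexI[of _ y]) simp_all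
  qed
  finally show ?thesis .
qed

text \<open>This reduces the nontriviality of \<open>H(i)\<close> to a statement about forms.\<close>

lemma H_subspace_nontrivial_iff_form:
  "H_subspace act \<eta> i1 i2 i3 \<noteq> {\<one>\<^bsub>H_space act\<^esub>} \<longleftrightarrow>
    (\<exists>F k1 k2 k3. invariant_form act F \<and>
      F (act (Poly_Mapping.single k1 1) (\<eta> i1)) (act (Poly_Mapping.single k2 1) (\<eta> i2))
        (act (Poly_Mapping.single k3 1) (\<eta> i3)) \<noteq> 0)"
proof -
  let ?g = "\<lambda>k1 k2 k3. triple (act (Poly_Mapping.single k1 1) (\<eta> i1))
    (act (Poly_Mapping.single k2 1) (\<eta> i2)) (act (Poly_Mapping.single k3 1) (\<eta> i3))"
  let ?S = "{?g k1 k2 k3 | k1 k2 k3. True}"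
  interpret V: vector_space "rat_scale :: rat \<Rightarrow> 'a triples \<Rightarrow> 'a triples"
    by (rule vector_space_rat_scale)
  have "H_subspace act \<eta> i1 i2 i3 = H_class act ` rat_span ?S"
    by (simp add: H_subspace_def Let_def)
  then have "H_subspace act \<eta> i1 i2 i3 = {\<one>\<^bsub>H_space act\<^esub>} \<longleftrightarrow>
      (\<forall>v\<in>rat_span ?S. H_class act v = \<one>\<^bsub>H_space act\<^esub>)"
    using V.span_zero[of ?S] by auto
  also have "\<dots> \<longleftrightarrow> rat_span ?S \<subseteq> rat_span (H_relators act)"
    unfolding H_class_eq_one_iff by blast
  also have "\<dots> \<longleftrightarrow> ?S \<subseteq> rat_span (H_relators act)"
    using V.span_superset V.span_minimal V.subspace_span by (meson order_trans)
  also have "\<dots> \<longleftrightarrow> (\<forall>k1 k2 k3. ?g k1 k2 k3 \<in> rat_span (H_relators act))" by blast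
  finally have "H_subspace act \<eta> i1 i2 i3 \<noteq> {\<one>\<^bsub>H_space act\<^esub>} \<longleftrightarrow>
      (\<exists>k1 k2 k3. ?g k1 k2 k3 \<notin> rat_span (H_relators act))" by (simp only: not_all)
  then have "H_subspace act \<eta> i1 i2 i3 \<noteq> {\<one>\<^bsub>H_space act\<^esub>} \<longleftrightarrow>
      (\<exists>k1 k2 k3 F. invariant_form act F \<and>
        F (act (Poly_Mapping.single k1 1) (\<eta> i1)) (act (Poly_Mapping.single k2 1) (\<eta> i2))
          (act (Poly_Mapping.single k3 1) (\<eta> i3)) \<noteq> 0)"
    by (simp only: not_in_span_iff_form)
  then show ?thesis by (simp only:) (rule iffI; elim exE; intro exI; assumption)
qed

lemma invariant_formD:
  assumes "invariant_form act F"
  shows "F (x + x') y z = F x y z + F x' y z" "F x (y + y') z = F x y z + F x y' z"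
    "F x y (z + z') = F x y z + F x y z'"
    "F (act (Poly_Mapping.single 0 c) x) y z = of_rat c * F x y z"
    "F x (act (Poly_Mapping.single 0 c) y) z = of_rat c * F x y z"
    "F x y (act (Poly_Mapping.single 0 c) z) = of_rat c * F x y z"
    "F x x y = 0" "F x y x = 0" "F y x x = 0"
    "F (t_mult act x) (t_mult act y) (t_mult act z) = F x y z"
  using assms unfolding invariant_form_def by simp_all

lemma invariant_form_skew:
  assumes "invariant_form act F"
  shows "F y x z = - F x y z" "F z y x = - F x y z" "F x z y = - F x y z"
proof -
  note add = invariant_formD(1-3)[OF assms] and alt = invariant_formD(7-9)[OF assms]
  have "F x (x + y) z + F y (x + y) z = 0" using add(1)[of x y "x + y" z] alt(1) by simp
  then show "F y x z = - F x y z" by (simp add: add(2) alt eq_neg_iff_add_eq_0 add.commute)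
  have "F x y (x + z) + F z y (x + z) = 0" using add(1)[of x z y "x + z"] alt(2) by simp
  then show "F z y x = - F x y z" by (simp add: add(3) alt eq_neg_iff_add_eq_0 add.commute)
  have "F x y (y + z) + F x z (y + z) = 0" using add(2)[of x y z "y + z"] alt(3) by simp
  then show "F x z y = - F x y z" by (simp add: add(3) alt eq_neg_iff_add_eq_0 add.commute)
qed

section \<open>Generalized eigenfunctionals on Laurent polynomials and on cyclic summands\<close>

lemma coeff_pairing_sum_fun:
  "coeff_pairing (\<lambda>k. \<Sum>s\<in>S. c s * g s k) p = (\<Sum>s\<in>S. c s * coeff_pairing (g s) p)"
  unfolding coeff_pairing_def sum_distrib_left
  by (subst sum.swap) (simp add: mult_ac)

text \<open>The sequences \<open>k\<^sup>s z\<^sup>k\<close> with \<open>s < m\<close> satisfy the recurrence with characteristic polynomial \<open>(t - z)\<^sup>m\<close>.\<close>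

lemma coeff_pairing_power_eq_0:
  assumes "[:-z, 1:] ^ m dvd p" "s < m"
  shows "coeff_pairing (\<lambda>k. of_nat k ^ s * z ^ k) p = 0"
  using assms
proof (induction m arbitrary: p s)
  case (Suc m)
  let ?f = "\<lambda>s k. of_nat k ^ s * z ^ k"
  obtain p' where p: "p = [:-z, 1:] * p'" and p': "[:-z, 1:] ^ m dvd p'"
    using Suc.prems(1) by (auto simp: mult.assoc simp del: mult_pCons_left elim!: dvdE)
  have shift: "?f s (Suc k) = (\<Sum>u\<le>s. (z * of_nat (s choose u)) * ?f u k)" for k
  proof -
    have "?f s (Suc k) = z * (of_nat k + 1) ^ s * z ^ k" by (simp add: add.commute)
    also have "(of_nat k + 1 :: complex) ^ s = (\<Sum>u\<le>s. of_nat (s choose u) * of_nat k ^ u)"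
      by (simp add: binomial_ring)
    finally show ?thesis by (simp add: sum_distrib_left sum_distrib_right mult_ac)
  qed
  have "p = [:0, 1:] * p' + smult (- z) p'" by (simp add: p)
  then have "coeff_pairing (?f s) p = coeff_pairing (?f s) ([:0, 1:] * p') - z * coeff_pairing (?f s) p'"
    using linear_on_poly_add[OF linear_coeff_pairing, of "?f s" "[:0, 1:] * p'" "smult (- z) p'"]
      linear_on_poly_smult[OF linear_coeff_pairing, of "?f s" "- z" p'] by simp
  also have "coeff_pairing (?f s) ([:0, 1:] * p') =
      (\<Sum>u\<le>s. (z * of_nat (s choose u)) * coeff_pairing (?f u) p')"
    unfolding coeff_pairing_mult_X shift coeff_pairing_sum_fun ..
  also have "\<dots> = (\<Sum>u<s. (z * of_nat (s choose u)) * coeff_pairing (?f u) p') + z * coeff_pairing (?f s) p'"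
    by (simp add: lessThan_Suc_atMost[symmetric])
  also have "(\<Sum>u<s. (z * of_nat (s choose u)) * coeff_pairing (?f u) p') = 0"
    using Suc.IH[OF p'] Suc.prems(2) by (intro sum.neutral) auto
  finally show ?case by simp
qed simp

lemma additive_eqI:
  fixes g h :: "('k \<Rightarrow>\<^sub>0 rat) \<Rightarrow> complex"
  assumes g: "\<And>v w. g (v + w) = g v + g w" and h: "\<And>v w. h (v + w) = h v + h w"
    and single: "\<And>k c. g (Poly_Mapping.single k c) = h (Poly_Mapping.single k c)"
  shows "g v = h v"
proof (induction v rule: Poly_Mapping.update_induct)
  case const
  then show ?case using g[of 0 0] h[of 0 0] by simp
next
  case (update v k c)
  have "Poly_Mapping.update k c v = Poly_Mapping.single k c + v"
    using update(1) by (intro poly_mapping_eqI)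
      (auto simp: lookup_update lookup_add lookup_single when_def in_keys_iff)
  then show ?case using update g h single by simp
qed

text \<open>The functional \<open>t\<^sup>k \<mapsto> k\<^sup>r z\<^sup>k\<close>, that is, \<open>P \<mapsto> (t d/dt)\<^sup>r P\<close> evaluated at \<open>z\<close>. For \<open>r = 0\<close> it is an
eigenvector of multiplication by \<open>t\<close>; for larger \<open>r\<close> it is a generalized one.\<close>

definition eigen_functional :: "complex \<Rightarrow> nat \<Rightarrow> laurent \<Rightarrow> complex" where
  "eigen_functional z r = rat_extension (\<lambda>k. of_int k ^ r * z powi k)"

lemma eigen_functional_add:
  "eigen_functional z r (P + Q) = eigen_functional z r P + eigen_functional z r Q"
  unfolding eigen_functional_def by (rule rat_extension_add)

lemma eigen_functional_single:
  "eigen_functional z r (Poly_Mapping.single k c) = of_rat c * (of_int k ^ r * z powi k)"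
  unfolding eigen_functional_def by (rule rat_extension_single)

lemma eigen_functional_scale:
  "eigen_functional z r (Poly_Mapping.single 0 c * P) = of_rat c * eigen_functional z r P"
  by (rule additive_eqI[of "\<lambda>P. eigen_functional z r (Poly_Mapping.single 0 c * P)"
        "\<lambda>P. of_rat c * eigen_functional z r P"])
    (simp_all add: distrib_left eigen_functional_add eigen_functional_single mult_single of_rat_mult)

lemma eigen_functional_shift:
  assumes "z \<noteq> 0"
  shows "eigen_functional z r (Poly_Mapping.single 1 1 * P) =
    z * (\<Sum>s\<le>r. of_nat (r choose s) * eigen_functional z s P)"
proof (rule additive_eqI[of "\<lambda>P. eigen_functional z r (Poly_Mapping.single 1 1 * P)"])
  fix k :: int and c :: rat
  have "of_int (1 + k) ^ r = (\<Sum>s\<le>r. of_nat (r choose s) * (of_int k :: complex) ^ s)"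
    by (simp add: add.commute[of 1] binomial_ring)
  moreover have "z powi (1 + k) = z * z powi k" using assms by (simp add: power_int_add)
  ultimately show "eigen_functional z r (Poly_Mapping.single 1 1 * Poly_Mapping.single k c) =
      z * (\<Sum>s\<le>r. of_nat (r choose s) * eigen_functional z s (Poly_Mapping.single k c))"
    by (simp add: mult_single eigen_functional_single sum_distrib_left sum_distrib_right mult_ac)
qed (simp_all add: eigen_functional_add distrib_left sum.distrib)

lemma eigen_functional_multiple_eq_0:
  assumes z: "z \<noteq> 0" and dvd: "[:-z, 1:] ^ m dvd map_poly of_rat \<delta>" and r: "r < m"
  shows "eigen_functional z r (laurent_of_poly \<delta> * P) = 0"
proof -
  have sum: "eigen_functional z r (sum g A) = (\<Sum>a\<in>A. eigen_functional z r (g a))"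
    for g and A :: "nat set"
    by (induction A rule: infinite_finite_induct)
      (simp_all add: eigen_functional_add, simp_all add: eigen_functional_def rat_extension_def)
  have single: "eigen_functional z r (laurent_of_poly \<delta> * Poly_Mapping.single n c) = 0" for n c
  proof -
    let ?g = "\<lambda>s k. of_nat k ^ s * z ^ k"
    have pow: "of_int (int k + n) ^ r * z powi (int k + n) =
        (\<Sum>s\<le>r. (z powi n * of_nat (r choose s) * of_int n ^ (r - s)) * ?g s k)" for k
    proof -
      have "of_int (int k + n) ^ r = (\<Sum>s\<le>r. of_nat (r choose s) * of_nat k ^ s * of_int n ^ (r - s) :: complex)"
        by (simp add: binomial_ring)
      moreover have "z powi (int k + n) = z powi n * z ^ k" using z by (simp add: power_int_add)
      ultimately show ?thesis by (simp add: sum_distrib_left sum_distrib_right mult_ac)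
    qed
    have "eigen_functional z r (laurent_of_poly \<delta> * Poly_Mapping.single n c) =
        (\<Sum>k\<le>degree \<delta>. of_rat (coeff \<delta> k * c) * (of_int (int k + n) ^ r * z powi (int k + n)))"
      unfolding laurent_of_poly_def sum_distrib_right sum mult_single eigen_functional_single ..
    also have "\<dots> = of_rat c * coeff_pairing (\<lambda>k. of_int (int k + n) ^ r * z powi (int k + n)) (map_poly of_rat \<delta>)"
      by (simp add: coeff_pairing_def degree_map_poly coeff_map_poly of_rat_mult sum_distrib_left mult_ac)
    also have "\<dots> = of_rat c * (\<Sum>s\<le>r. (z powi n * of_nat (r choose s) * of_int n ^ (r - s)) *
        coeff_pairing (?g s) (map_poly of_rat \<delta>))"
      unfolding pow coeff_pairing_sum_fun ..
    also have "\<dots> = 0"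
      using coeff_pairing_power_eq_0[OF dvd] r by simp
    finally show ?thesis .
  qed
  show ?thesis
    by (rule additive_eqI[of "\<lambda>P. eigen_functional z r (laurent_of_poly \<delta> * P)" "\<lambda>_. 0"])
      (simp_all add: distrib_left eigen_functional_add single)
qed

text \<open>The module is the direct sum of the submodules generated by the \<open>\<eta>\<^sub>i\<close>, and \<open>\<eta>\<^sub>i\<close> has annihilator
\<open>(\<Delta>\<^sub>i)\<close>. Components are indexed extensionally, so that the family of components is unique.\<close>

definition cyclic_decomposition ::
  "(laurent \<Rightarrow> 'a::ab_group_add \<Rightarrow> 'a) \<Rightarrow> nat \<Rightarrow> (nat \<Rightarrow> 'a) \<Rightarrow> (nat \<Rightarrow> laurent) \<Rightarrow> bool" where
  "cyclic_decomposition act q \<eta> \<Delta> \<longleftrightarrow>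
     (\<forall>x. \<exists>!f. f \<in> (\<Pi>\<^sub>E i\<in>{1..q}. range (\<lambda>P. act P (\<eta> i))) \<and> x = (\<Sum>i=1..q. f i)) \<and>
     (\<forall>i\<in>{1..q}. \<forall>P. act P (\<eta> i) = 0 \<longleftrightarrow> \<Delta> i dvd P)"

lemma cyclic_decomposition_generates:
  assumes "cyclic_decomposition act q \<eta> \<Delta>"
  obtains P where "x = (\<Sum>i=1..q. act (P i) (\<eta> i))"
proof -
  obtain f where f: "f \<in> (\<Pi>\<^sub>E i\<in>{1..q}. range (\<lambda>P. act P (\<eta> i)))" "x = (\<Sum>i=1..q. f i)"
    using spec[OF assms[unfolded cyclic_decomposition_def, THEN conjunct1], of x]
    by (elim ex1E conjE) (rule that)
  have "\<exists>P. \<forall>i\<in>{1..q}. f i = act (P i) (\<eta> i)"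
    using f(1) by (intro bchoice) (auto simp: PiE_iff image_iff)
  then show ?thesis using that f(2) by (metis (no_types, lifting) sum.cong)
qed

text \<open>A functional on \<open>Q[t,t\<^sup>-\<^sup>1]/(\<Delta>\<^sub>i)\<close>, extended by zero to the other summands.\<close>

lemma cyclic_decomposition_functional:
  fixes e :: "laurent \<Rightarrow> complex"
  assumes mod: "module act" and dec: "cyclic_decomposition act q \<eta> \<Delta>" and i: "i \<in> {1..q}"
    and add: "\<And>P Q. e (P + Q) = e P + e Q" and zero: "\<And>P. e (\<Delta> i * P) = 0"
  obtains \<phi> where "\<And>P. \<phi> (\<Sum>j=1..q. act (P j) (\<eta> j)) = e (P i)"
proof -
  interpret module act by (rule mod)
  let ?comp = "\<lambda>x f. f \<in> (\<Pi>\<^sub>E j\<in>{1..q}. range (\<lambda>P. act P (\<eta> j))) \<and> x = (\<Sum>j=1..q. f j)"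
  define \<phi> where "\<phi> x = e (SOME Q. act Q (\<eta> i) = (THE f. ?comp x f) i)" for x
  have "\<phi> (\<Sum>j=1..q. act (P j) (\<eta> j)) = e (P i)" for P
  proof -
    let ?f = "restrict (\<lambda>j. act (P j) (\<eta> j)) {1..q}"
    have "?comp (\<Sum>j=1..q. act (P j) (\<eta> j)) ?f" by auto
    moreover have "\<exists>!f. ?comp (\<Sum>j=1..q. act (P j) (\<eta> j)) f"
      by (rule spec[OF dec[unfolded cyclic_decomposition_def, THEN conjunct1]])
    ultimately have "(THE f. ?comp (\<Sum>j=1..q. act (P j) (\<eta> j)) f) = ?f" by (rule the1_equality[rotated])
    then have \<phi>: "\<phi> (\<Sum>j=1..q. act (P j) (\<eta> j)) = e (SOME Q. act Q (\<eta> i) = act (P i) (\<eta> i))"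
      unfolding \<phi>_def using i by simp
    define Q where "Q = (SOME Q. act Q (\<eta> i) = act (P i) (\<eta> i))"
    have "act Q (\<eta> i) = act (P i) (\<eta> i)" unfolding Q_def
      using someI[of "\<lambda>Q. act Q (\<eta> i) = act (P i) (\<eta> i)" "P i"] by simp
    then have "act (Q - P i) (\<eta> i) = 0" by (simp add: scale_left_diff_distrib)
    then have "\<Delta> i dvd Q - P i" using dec i unfolding cyclic_decomposition_def by blast
    then obtain R where "Q - P i = \<Delta> i * R" by (rule dvdE)
    then have "Q = P i + \<Delta> i * R" by (simp add: algebra_simps)
    then have "e Q = e (P i)" using add zero by simp
    then show ?thesis unfolding \<phi> Q_def[symmetric] .
  qed
  then show ?thesis using that by blast
qed

text \<open>Rational-linear functionals \<open>\<phi> 0, \<dots>, \<phi> (m - 1)\<close> on the module that are supported on the \<open>i\<close>-th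
summand and are there the functionals \<open>t\<^sup>k \<mapsto> k\<^sup>r z\<^sup>k\<close>; the action of \<open>t\<close> on them is \<open>z\<close> times a
unipotent triangular matrix.\<close>

definition eigen_chain ::
  "(laurent \<Rightarrow> 'a::ab_group_add \<Rightarrow> 'a) \<Rightarrow> nat \<Rightarrow> (nat \<Rightarrow> 'a) \<Rightarrow> nat \<Rightarrow> complex \<Rightarrow> nat \<Rightarrow> (nat \<Rightarrow> 'a \<Rightarrow> complex) \<Rightarrow> bool" where
  "eigen_chain act q \<eta> i z m \<phi> \<longleftrightarrow> (\<forall>r<m.
     (\<forall>x y. \<phi> r (x + y) = \<phi> r x + \<phi> r y) \<and>
     (\<forall>c x. \<phi> r (act (Poly_Mapping.single 0 c) x) = of_rat c * \<phi> r x) \<and>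
     (\<forall>x. \<phi> r (t_mult act x) = z * (\<Sum>s\<le>r. of_nat (r choose s) * \<phi> s x)) \<and>
     (\<forall>j\<in>{1..q}. \<forall>k. \<phi> r (act (Poly_Mapping.single k 1) (\<eta> j)) =
        (if j = i then of_int k ^ r * z powi k else 0)))"

lemma eigen_chain_exists:
  assumes mod: "module act" and dec: "cyclic_decomposition act q \<eta> \<Delta>" and i: "i \<in> {1..q}"
    and \<Delta>: "\<Delta> i = laurent_of_poly \<delta>" and z: "z \<noteq> 0" and dvd: "[:-z, 1:] ^ m dvd map_poly of_rat \<delta>"
  obtains \<phi> where "eigen_chain act q \<eta> i z m \<phi>"
proof -
  interpret module act by (rule mod)
  have "\<exists>\<phi>. \<forall>P. \<phi> (\<Sum>j=1..q. act (P j) (\<eta> j)) = eigen_functional z r (P i)" if "r < m" for r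
    using cyclic_decomposition_functional[OF mod dec i, of "eigen_functional z r"]
      eigen_functional_add eigen_functional_multiple_eq_0[OF z dvd that, folded \<Delta>] by metis
  then obtain \<phi> where \<phi>: "\<And>r P. r < m \<Longrightarrow> \<phi> r (\<Sum>j=1..q. act (P j) (\<eta> j)) = eigen_functional z r (P i)"
    by metis
  have "eigen_chain act q \<eta> i z m \<phi>"
    unfolding eigen_chain_def
  proof (intro allI impI conjI ballI)
    fix r x y assume r: "r < m"
    obtain P where P: "x = (\<Sum>j=1..q. act (P j) (\<eta> j))" by (rule cyclic_decomposition_generates[OF dec])
    obtain Q where Q: "y = (\<Sum>j=1..q. act (Q j) (\<eta> j))" by (rule cyclic_decomposition_generates[OF dec])
    have "x + y = (\<Sum>j=1..q. act (P j + Q j) (\<eta> j))"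
      unfolding P Q by (simp add: scale_left_distrib sum.distrib)
    then show "\<phi> r (x + y) = \<phi> r x + \<phi> r y"
      using \<phi>[OF r, of "\<lambda>j. P j + Q j"] \<phi>[OF r, of P] \<phi>[OF r, of Q] P Q
      by (simp add: eigen_functional_add)
  next
    fix r c x assume r: "r < m"
    obtain P where P: "x = (\<Sum>j=1..q. act (P j) (\<eta> j))" by (rule cyclic_decomposition_generates[OF dec])
    have "act R x = (\<Sum>j=1..q. act (R * P j) (\<eta> j))" for R
      unfolding P by (simp add: scale_sum_right)
    then show "\<phi> r (act (Poly_Mapping.single 0 c) x) = of_rat c * \<phi> r x"
      using \<phi>[OF r, of "\<lambda>j. Poly_Mapping.single 0 c * P j"] \<phi>[OF r, of P] P
      by (simp add: eigen_functional_scale)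
  next
    fix r x assume r: "r < m"
    obtain P where P: "x = (\<Sum>j=1..q. act (P j) (\<eta> j))" by (rule cyclic_decomposition_generates[OF dec])
    have "t_mult act x = (\<Sum>j=1..q. act (Poly_Mapping.single 1 1 * P j) (\<eta> j))"
      unfolding P by (simp add: scale_sum_right)
    then have "\<phi> r (t_mult act x) = z * (\<Sum>s\<le>r. of_nat (r choose s) * eigen_functional z s (P i))"
      using \<phi>[OF r, of "\<lambda>j. Poly_Mapping.single 1 1 * P j"] by (simp only: eigen_functional_shift[OF z])
    also have "(\<Sum>s\<le>r. of_nat (r choose s) * eigen_functional z s (P i)) = (\<Sum>s\<le>r. of_nat (r choose s) * \<phi> s x)"
      using \<phi>[of _ P] r P by (intro sum.cong) auto
    finally show "\<phi> r (t_mult act x) = z * (\<Sum>s\<le>r. of_nat (r choose s) * \<phi> s x)" .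
  next
    fix r j k assume r: "r < m" and j: "j \<in> {1..q}"
    let ?P = "\<lambda>l. if l = j then Poly_Mapping.single k 1 else (0 :: laurent)"
    have "(\<Sum>l=1..q. act (?P l) (\<eta> l)) = (\<Sum>l=1..q. if l = j then act (Poly_Mapping.single k 1) (\<eta> l) else 0)"
      by (intro sum.cong) auto
    also have "\<dots> = act (Poly_Mapping.single k 1) (\<eta> j)" using j by simp
    finally have "\<phi> r (act (Poly_Mapping.single k 1) (\<eta> j)) = eigen_functional z r (?P i)"
      using \<phi>[OF r, of ?P] by simp
    then show "\<phi> r (act (Poly_Mapping.single k 1) (\<eta> j)) = (if j = i then of_int k ^ r * z powi k else 0)"
      using eigen_functional_single[of z r k 1] eigen_functional_single[of z r 0 0] by auto
  qed
  then show ?thesis using that by blast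
qed

lemma eigen_chainD:
  assumes "eigen_chain act q \<eta> i z m \<phi>" "r < m"
  shows "\<phi> r (x + y) = \<phi> r x + \<phi> r y"
    "\<phi> r (act (Poly_Mapping.single 0 c) x) = of_rat c * \<phi> r x"
    "\<phi> r (t_mult act x) = z * (\<Sum>s\<le>r. of_nat (r choose s) * \<phi> s x)"
    "j \<in> {1..q} \<Longrightarrow> \<phi> r (act (Poly_Mapping.single k 1) (\<eta> j)) =
      (if j = i then of_int k ^ r * z powi k else 0)"
  using assms(1)[unfolded eigen_chain_def, THEN spec[of _ r], THEN mp, OF assms(2)]
  by (elim conjE, simp only:)+

section \<open>Invariant forms from roots\<close>

text \<open>The form is the determinant of the matrix of values of \<open>p1, p2, p3\<close>. The action of \<open>t\<close> on these
functionals is triangular with diagonal \<open>z\<^sub>1, z\<^sub>2, z\<^sub>3\<close>, so it multiplies the form by \<open>z\<^sub>1 z\<^sub>2 z\<^sub>3\<close>.\<close>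

lemma det3_invariant_form:
  fixes p1 p2 p3 :: "'a::ab_group_add \<Rightarrow> complex"
  assumes add: "\<And>x y. p1 (x + y) = p1 x + p1 y" "\<And>x y. p2 (x + y) = p2 x + p2 y"
      "\<And>x y. p3 (x + y) = p3 x + p3 y"
    and scale: "\<And>c x. p1 (act (Poly_Mapping.single 0 c) x) = of_rat c * p1 x"
      "\<And>c x. p2 (act (Poly_Mapping.single 0 c) x) = of_rat c * p2 x"
      "\<And>c x. p3 (act (Poly_Mapping.single 0 c) x) = of_rat c * p3 x"
    and t: "\<And>x. p1 (t_mult act x) = z1 * p1 x" "\<And>x. p2 (t_mult act x) = z2 * (p2 x + \<alpha> * p1 x)"
      "\<And>x. p3 (t_mult act x) = z3 * (p3 x + \<beta> * p2 x + \<gamma> * p1 x)"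
    and prod: "z1 * z2 * z3 = 1"
  shows "invariant_form act (\<lambda>x y z. p1 x * (p2 y * p3 z - p2 z * p3 y)
    - p1 y * (p2 x * p3 z - p2 z * p3 x) + p1 z * (p2 x * p3 y - p2 y * p3 x))"
proof -
  let ?D = "\<lambda>x y z. p1 x * (p2 y * p3 z - p2 z * p3 y)
    - p1 y * (p2 x * p3 z - p2 z * p3 x) + p1 z * (p2 x * p3 y - p2 y * p3 x)"
  have "?D (t_mult act x) (t_mult act y) (t_mult act z) = (z1 * z2 * z3) * ?D x y z" for x y z
    unfolding t by (simp add: algebra_simps)
  then have inv: "?D (t_mult act x) (t_mult act y) (t_mult act z) = ?D x y z" for x y z
    by (simp add: prod)
  show ?thesis
    unfolding invariant_form_def
    by (intro conjI allI, simp_all only: inv) (simp_all add: add scale algebra_simps)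
qed

text \<open>The number \<open>p\<^sub>j k i\<^sub>l\<close> is the value of the \<open>j\<close>-th functional at \<open>t\<^sup>k \<eta>\<^sub>i\<close> with \<open>i = i\<^sub>l\<close>. The exponent
\<open>r\<^sub>j\<close> counts the earlier slots with the same index and root, and \<open>k\<^sub>l\<close> counts the earlier slots with the
same index. The matrix is block diagonal, with one confluent Vandermonde block, up to invertible
factors, for each index that occurs.\<close>

lemma det3_eigen_values_nonzero:
  fixes i1 i2 i3 :: nat and z1 z2 z3 :: complex
  defines "r2 \<equiv> of_bool (i1 = i2 \<and> z1 = z2)"
    and "r3 \<equiv> of_bool (i1 = i3 \<and> z1 = z3) + of_bool (i2 = i3 \<and> z2 = z3)"
    and "k2 \<equiv> of_bool (i1 = i2)" and "k3 \<equiv> of_bool (i1 = i3) + of_bool (i2 = i3)"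
  defines "p1 \<equiv> \<lambda>k i. if i = i1 then z1 ^ k else 0"
    and "p2 \<equiv> \<lambda>k i. if i = i2 then of_nat k ^ r2 * z2 ^ k else 0"
    and "p3 \<equiv> \<lambda>k i. if i = i3 then of_nat k ^ r3 * z3 ^ k else 0"
  assumes nz: "z1 \<noteq> 0" "z2 \<noteq> 0" "z3 \<noteq> 0"
  shows "p1 0 i1 * (p2 k2 i2 * p3 k3 i3 - p2 k3 i3 * p3 k2 i2)
    - p1 k2 i2 * (p2 0 i1 * p3 k3 i3 - p2 k3 i3 * p3 0 i1)
    + p1 k3 i3 * (p2 0 i1 * p3 k2 i2 - p2 k2 i2 * p3 0 i1) \<noteq> 0"
proof (cases "i1 = i2 \<and> i2 = i3")
  case False
  show ?thesis
  proof -
    consider "i1 \<noteq> i2" "i1 \<noteq> i3" "i2 \<noteq> i3" | "i1 = i2" "i1 \<noteq> i3" | "i1 = i3" "i1 \<noteq> i2" | "i2 = i3" "i1 \<noteq> i2"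
      using False by blast
    then show ?thesis
    proof cases
      case 1
      then show ?thesis by (simp add: p1_def p2_def p3_def r2_def r3_def k2_def k3_def)
    next
      case 2
      then show ?thesis using nz
        by (cases "z1 = z2") (simp_all add: p1_def p2_def p3_def r2_def r3_def k2_def k3_def)
    next
      case 3
      then show ?thesis using nz
        by (cases "z1 = z3") (simp_all add: p1_def p2_def p3_def r2_def r3_def k2_def k3_def)
    next
      case 4
      then show ?thesis using nz
        by (cases "z2 = z3") (simp_all add: p1_def p2_def p3_def r2_def r3_def k2_def k3_def)
    qed
  qed
next
  case True
  then have i: "i2 = i1" "i3 = i1" by auto
  have k: "k2 = 1" "k3 = 2" by (simp_all add: k2_def k3_def i)
  consider "z1 \<noteq> z2" "z1 \<noteq> z3" "z2 \<noteq> z3" | "z1 = z2" "z1 \<noteq> z3" | "z1 = z3" "z1 \<noteq> z2" | "z2 = z3" "z1 \<noteq> z2"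
    | "z1 = z2" "z1 = z3" by blast
  then show ?thesis
  proof cases
    case 1
    have "(z2 - z1) * (z3 - z1) * (z3 - z2) \<noteq> 0" using 1 by simp
    then show ?thesis using 1 by (simp add: p1_def p2_def p3_def r2_def r3_def k i power2_eq_square algebra_simps)
  next
    case 2
    have "z1 * (z3 - z1) ^ 2 \<noteq> 0" using 2 nz by simp
    then show ?thesis using 2 by (simp add: p1_def p2_def p3_def r2_def r3_def k i power2_eq_square algebra_simps)
  next
    case 3
    have "z1 * (z2 - z1) ^ 2 \<noteq> 0" using 3 nz by simp
    then show ?thesis using 3 by (simp add: p1_def p2_def p3_def r2_def r3_def k i power2_eq_square algebra_simps)
  next
    case 4
    have "z2 * (z2 - z1) ^ 2 \<noteq> 0" using 4 nz by simp
    then show ?thesis using 4 by (simp add: p1_def p2_def p3_def r2_def r3_def k i power2_eq_square algebra_simps)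
  next
    case 5
    have "z1 ^ 3 \<noteq> 0" using nz by simp
    then show ?thesis using 5 by (simp add: p1_def p2_def p3_def r2_def r3_def k i power2_eq_square power3_eq_cube algebra_simps)
  qed
qed

lemma form_from_roots:
  fixes \<delta> :: "nat \<Rightarrow> rat poly" and z1 z2 z3 :: complex
  assumes mod: "module act" and dec: "cyclic_decomposition act q \<eta> (\<lambda>i. laurent_of_poly (\<delta> i))"
    and i: "i1 \<in> {1..q}" "i2 \<in> {1..q}" "i3 \<in> {1..q}"
    and dvd: "[:-z1, 1:] ^ m i1 dvd map_poly of_rat (\<delta> i1)" "[:-z2, 1:] ^ m i2 dvd map_poly of_rat (\<delta> i2)"
      "[:-z3, 1:] ^ m i3 dvd map_poly of_rat (\<delta> i3)"
    and prod: "z1 * z2 * z3 = 1"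
    and m: "m i1 \<ge> 1" "m i2 \<ge> 1" "m i3 \<ge> 1"
      "i1 = i2 \<and> z1 = z2 \<longrightarrow> m i1 \<ge> 2" "i1 = i3 \<and> z1 = z3 \<longrightarrow> m i1 \<ge> 2" "i2 = i3 \<and> z2 = z3 \<longrightarrow> m i2 \<ge> 2"
      "i1 = i2 \<and> z1 = z2 \<and> i1 = i3 \<and> z1 = z3 \<longrightarrow> m i1 \<ge> 3"
  shows "\<exists>F k1 k2 k3. invariant_form act F \<and>
      F (act (Poly_Mapping.single k1 1) (\<eta> i1)) (act (Poly_Mapping.single k2 1) (\<eta> i2))
        (act (Poly_Mapping.single k3 1) (\<eta> i3)) \<noteq> 0"
proof -
  have nz: "z1 \<noteq> 0" "z2 \<noteq> 0" "z3 \<noteq> 0" using prod by auto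
  define \<Phi> where "\<Phi> i z = (SOME \<phi>. eigen_chain act q \<eta> i z (m i) \<phi>)" for i z
  have \<Phi>: "eigen_chain act q \<eta> i z (m i) (\<Phi> i z)"
    if a: "i \<in> {1..q}" "z \<noteq> 0" "[:-z, 1:] ^ m i dvd map_poly of_rat (\<delta> i)" for i z
  proof -
    obtain \<phi> where "eigen_chain act q \<eta> i z (m i) \<phi>"
      by (rule eigen_chain_exists[OF mod dec a(1) refl a(2,3)])
    then show ?thesis unfolding \<Phi>_def by (rule someI[of "eigen_chain act q \<eta> i z (m i)"])
  qed
  note ch = \<Phi>[OF i(1) nz(1) dvd(1)] \<Phi>[OF i(2) nz(2) dvd(2)] \<Phi>[OF i(3) nz(3) dvd(3)]
  define r2 :: nat where "r2 = of_bool (i1 = i2 \<and> z1 = z2)"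
  define r3 :: nat where "r3 = of_bool (i1 = i3 \<and> z1 = z3) + of_bool (i2 = i3 \<and> z2 = z3)"
  have lt: "0 < m i1" "r2 < m i2" "r3 < m i3"
    using m by (auto simp: r2_def r3_def)
  let ?p1 = "\<Phi> i1 z1 0" and ?p2 = "\<Phi> i2 z2 r2" and ?p3 = "\<Phi> i3 z3 r3"
  note D1 = eigen_chainD[OF ch(1) lt(1)] and D2 = eigen_chainD[OF ch(2) lt(2)]
    and D3 = eigen_chainD[OF ch(3) lt(3)]
  note t = D1(3) D2(3) D3(3)
  have t1: "?p1 (t_mult act x) = z1 * ?p1 x" for x using t(1) by simp
  obtain \<alpha> where t2: "\<And>x. ?p2 (t_mult act x) = z2 * (?p2 x + \<alpha> * ?p1 x)"
  proof (cases "i1 = i2 \<and> z1 = z2")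
    case True
    then have "r2 = 1" by (simp add: r2_def)
    then show ?thesis using t(2) True by (intro that[of 1]) (simp add: algebra_simps)
  next
    case False
    then have "r2 = 0" unfolding r2_def by simp
    then show ?thesis using t(2) by (intro that[of 0]) simp
  qed
  have "\<exists>\<beta> \<gamma>. \<forall>x. ?p3 (t_mult act x) = z3 * (?p3 x + \<beta> * ?p2 x + \<gamma> * ?p1 x)"
  proof (cases "i1 = i3 \<and> z1 = z3"; cases "i2 = i3 \<and> z2 = z3")
    assume *: "i1 = i3 \<and> z1 = z3" "i2 = i3 \<and> z2 = z3"
    then have "r2 = 1" "r3 = 2" by (simp_all add: r2_def r3_def)
    then show ?thesis using t(3) *
      by (intro exI[of _ 2] exI[of _ 1]) (simp add: numeral_2_eq_2 algebra_simps)
  next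
    assume *: "i1 = i3 \<and> z1 = z3" "\<not> (i2 = i3 \<and> z2 = z3)"
    then have "r3 = 1" by (simp add: r3_def)
    then show ?thesis using t(3) * by (intro exI[of _ 0] exI[of _ 1]) (simp add: algebra_simps)
  next
    assume *: "\<not> (i1 = i3 \<and> z1 = z3)" "i2 = i3 \<and> z2 = z3"
    then have "r2 = 0" "r3 = 1" by (auto simp: r2_def r3_def)
    then show ?thesis using t(3) * by (intro exI[of _ 1] exI[of _ 0]) (simp add: algebra_simps)
  next
    assume *: "\<not> (i1 = i3 \<and> z1 = z3)" "\<not> (i2 = i3 \<and> z2 = z3)"
    then have "r3 = 0" unfolding r3_def by simp
    then show ?thesis using t(3) by (intro exI[of _ 0]) simp
  qed
  then obtain \<beta> \<gamma> where t3: "\<And>x. ?p3 (t_mult act x) = z3 * (?p3 x + \<beta> * ?p2 x + \<gamma> * ?p1 x)" by blast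
  define F where "F x y z = ?p1 x * (?p2 y * ?p3 z - ?p2 z * ?p3 y)
    - ?p1 y * (?p2 x * ?p3 z - ?p2 z * ?p3 x) + ?p1 z * (?p2 x * ?p3 y - ?p2 y * ?p3 x)" for x y z
  have "invariant_form act F"
    unfolding F_def by (rule det3_invariant_form[OF D1(1) D2(1) D3(1) D1(2) D2(2) D3(2) t1 t2 t3 prod])
  moreover
  define k2 :: nat where "k2 = of_bool (i1 = i2)"
  define k3 :: nat where "k3 = of_bool (i1 = i3) + of_bool (i2 = i3)"
  have "F (act (Poly_Mapping.single (int 0) 1) (\<eta> i1)) (act (Poly_Mapping.single (int k2) 1) (\<eta> i2))
      (act (Poly_Mapping.single (int k3) 1) (\<eta> i3)) \<noteq> 0"
    using det3_eigen_values_nonzero[OF nz, of i1 i2 i3]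
    unfolding F_def D1(4)[OF i(1)] D1(4)[OF i(2)] D1(4)[OF i(3)] D2(4)[OF i(1)] D2(4)[OF i(2)]
      D2(4)[OF i(3)] D3(4)[OF i(1)] D3(4)[OF i(2)] D3(4)[OF i(3)] r2_def[symmetric] r3_def[symmetric]
      k2_def[symmetric] k3_def[symmetric]
    by (simp only: power_int_of_nat of_int_of_nat_eq power_0 mult_1_left not_False_eq_True)
  ultimately show ?thesis by blast
qed

section \<open>Roots from invariant forms\<close>

text \<open>The values of a functional along \<open>t\<^sup>k x\<close> satisfy the recurrence whose characteristic polynomial
annihilates \<open>x\<close>.\<close>

lemma functional_of_multiple:
  fixes g :: "'a::ab_group_add \<Rightarrow> complex"
  assumes mod: "module act" and add: "\<And>x y. g (x + y) = g x + g y"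
    and scale: "\<And>c x. g (act (Poly_Mapping.single 0 c) x) = of_rat c * g x"
    and ann: "act (laurent_of_poly \<delta>) x = 0"
  shows "coeff_pairing (\<lambda>k. g (act (Poly_Mapping.single (int (k + n)) 1) x)) (map_poly of_rat \<delta>) = 0"
proof -
  interpret module act by (rule mod)
  have zero: "g 0 = 0" using add[of 0 0] by simp
  have sum: "g (sum h A) = (\<Sum>a\<in>A. g (h a))" for h and A :: "nat set"
    by (induction A rule: infinite_finite_induct) (simp_all add: add zero)
  have "0 = g (act (Poly_Mapping.single (int n) 1 * laurent_of_poly \<delta>) x)"
    using ann zero by (simp flip: scale_scale)
  also have "Poly_Mapping.single (int n) 1 * laurent_of_poly \<delta> =
      (\<Sum>k\<le>degree \<delta>. Poly_Mapping.single 0 (coeff \<delta> k) * Poly_Mapping.single (int (k + n)) 1)"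
    by (simp add: laurent_of_poly_def sum_distrib_left mult_single add.commute)
  also have "g (act \<dots> x) = (\<Sum>k\<le>degree \<delta>. of_rat (coeff \<delta> k) * g (act (Poly_Mapping.single (int (k + n)) 1) x))"
    by (simp only: scale_sum_left sum scale scale_scale[symmetric])
  also have "\<dots> = coeff_pairing (\<lambda>k. g (act (Poly_Mapping.single (int (k + n)) 1) x)) (map_poly of_rat \<delta>)"
    by (simp add: coeff_pairing_def degree_map_poly coeff_map_poly)
  finally show ?thesis by simp
qed

lemma roots_from_form:
  fixes \<delta> :: "nat \<Rightarrow> rat poly"
  assumes mod: "module act"
    and ann: "\<And>l. l \<in> {i1, i2, i3} \<Longrightarrow> act (laurent_of_poly (\<delta> l)) (\<eta> l) = 0"
    and prime: "\<And>l. l \<in> {i1, i2, i3} \<Longrightarrow> \<exists>\<pi>. prime_elem \<pi> \<and> \<delta> l = \<pi> ^ m l"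
    and F: "invariant_form act F"
    and nz: "F (act (Poly_Mapping.single k1 1) (\<eta> i1)) (act (Poly_Mapping.single k2 1) (\<eta> i2))
        (act (Poly_Mapping.single k3 1) (\<eta> i3)) \<noteq> 0"
  obtains z1 z2 z3 :: complex where "poly (map_poly of_rat (\<delta> i1)) z1 = 0"
    "poly (map_poly of_rat (\<delta> i2)) z2 = 0" "poly (map_poly of_rat (\<delta> i3)) z3 = 0" "z1 * z2 * z3 = 1"
    "i1 = i2 \<and> z1 = z2 \<longrightarrow> m i1 \<ge> 2" "i1 = i3 \<and> z1 = z3 \<longrightarrow> m i1 \<ge> 2" "i2 = i3 \<and> z2 = z3 \<longrightarrow> m i2 \<ge> 2"
    "i1 = i2 \<and> z1 = z2 \<and> i1 = i3 \<and> z1 = z3 \<longrightarrow> m i1 \<ge> 3"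
proof -
  interpret module act by (rule mod)
  let ?f = "\<lambda>a b c. F (act (Poly_Mapping.single a 1) (\<eta> i1)) (act (Poly_Mapping.single b 1) (\<eta> i2))
        (act (Poly_Mapping.single c 1) (\<eta> i3))"
  note add = invariant_formD(1-3)[OF F] and scale = invariant_formD(4-6)[OF F]
    and inv = invariant_formD(10)[OF F]
  have t: "act (Poly_Mapping.single (1 + a) 1) x = t_mult act (act (Poly_Mapping.single a 1) x)" for a x
    by (simp add: mult_single)
  have step: "?f (1 + a) (1 + b) (1 + c) = ?f a b c" for a b c unfolding t inv ..
  have shift: "?f (int n + a) (int n + b) (int n + c) = ?f a b c" for n a b c
  proof (induction n)
    case (Suc n)
    have "int (Suc n) + k = 1 + (int n + k)" for k by simp
    then show ?case by (simp only: step Suc)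
  qed simp
  \<comment> \<open>by invariance under \<open>t\<close>, the exponents may be taken nonnegative\<close>
  define N where "N = nat (\<bar>k1\<bar> + \<bar>k2\<bar> + \<bar>k3\<bar>)"
  define f where "f a b c = ?f (int a) (int b) (int c)" for a b c
  have "0 \<le> int N + k1" "0 \<le> int N + k2" "0 \<le> int N + k3" unfolding N_def by linarith+
  then have "f (nat (int N + k1)) (nat (int N + k2)) (nat (int N + k3)) = ?f k1 k2 k3"
    unfolding f_def shift[of N k1 k2 k3, symmetric] by (simp only: int_nat_eq if_True)
  then have f_nz: "f (nat (int N + k1)) (nat (int N + k2)) (nat (int N + k3)) \<noteq> 0" using nz by simp
  have e: "\<exists>e. \<forall>l\<in>{i1, i2, i3}. \<forall>z. poly (map_poly of_rat (\<delta> l)) z = 0 \<longrightarrow>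
      map_poly of_rat (\<delta> l) = [:-z, 1:] ^ m l * e l z \<and> poly (e l z) (z :: complex) \<noteq> 0"
  proof -
    have "\<exists>e. poly (map_poly of_rat (\<delta> l)) z = 0 \<longrightarrow>
        map_poly of_rat (\<delta> l) = [:-z, 1:] ^ m l * e \<and> poly e (z :: complex) \<noteq> 0"
      if "l \<in> {i1, i2, i3}" for l z
      using prime[OF that] prime_power_root_multiplicity by metis
    then show ?thesis by metis
  qed
  then obtain e where e: "\<And>l z. l \<in> {i1, i2, i3} \<Longrightarrow> poly (map_poly of_rat (\<delta> l)) z = 0 \<Longrightarrow>
      map_poly of_rat (\<delta> l) = [:-z, 1:] ^ m l * e l z \<and> poly (e l z) (z :: complex) \<noteq> 0"
    by metis
  show ?thesis
  proof (rule admissible_roots[of f "\<lambda>l. map_poly of_rat (\<delta> l)" i1 i2 i3 m e])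
    show "coeff_pairing (\<lambda>k. f (k + n) b c) (map_poly of_rat (\<delta> i1)) = 0" for n b c
      unfolding f_def by (rule functional_of_multiple[OF mod, of "\<lambda>x. F x _ _"]) (simp_all add: add scale ann)
    show "coeff_pairing (\<lambda>k. f a (k + n) c) (map_poly of_rat (\<delta> i2)) = 0" for n a c
      unfolding f_def by (rule functional_of_multiple[OF mod, of "\<lambda>x. F _ x _"]) (simp_all add: add scale ann)
    show "coeff_pairing (\<lambda>k. f a b (k + n)) (map_poly of_rat (\<delta> i3)) = 0" for n a b
      unfolding f_def by (rule functional_of_multiple[OF mod, of "\<lambda>x. F _ _ x"]) (simp_all add: add scale ann)
    show "f (Suc a) (Suc b) (Suc c) = f a b c" for a b c
      unfolding f_def using step by simp
    show "i1 = i2 \<Longrightarrow> f b a c = - f a b c" for a b c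
      unfolding f_def by (simp add: invariant_form_skew(1)[OF F, of "act (Poly_Mapping.single (int b) 1) (\<eta> i2)"])
    show "i1 = i3 \<Longrightarrow> f c b a = - f a b c" for a b c
      unfolding f_def by (simp add: invariant_form_skew(2)[OF F, of "act (Poly_Mapping.single (int c) 1) (\<eta> i3)"])
    show "i2 = i3 \<Longrightarrow> f a c b = - f a b c" for a b c
      unfolding f_def by (simp add: invariant_form_skew(3)[OF F, of _ "act (Poly_Mapping.single (int c) 1) (\<eta> i3)"])
    show "f (nat (int N + k1)) (nat (int N + k2)) (nat (int N + k3)) \<noteq> 0" by (rule f_nz)
  qed (use e that in blast)+
qed

section \<open>The nontriviality criterion\<close>

text \<open>The multiplicity condition of the theorem, written out for three slots. The right-hand side is the form
in which both implications use it.\<close>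

lemma card_le_iff_distinct_pairs:
  fixes i m :: "nat \<Rightarrow> nat" and z :: "nat \<Rightarrow> complex"
  shows "(\<forall>j\<in>{1..3}. card {l\<in>{1..3}. i l = i j \<and> z l = z j} \<le> m (i j)) \<longleftrightarrow>
    m (i 1) \<ge> 1 \<and> m (i 2) \<ge> 1 \<and> m (i 3) \<ge> 1 \<and>
    (i 1 = i 2 \<and> z 1 = z 2 \<longrightarrow> m (i 1) \<ge> 2) \<and> (i 1 = i 3 \<and> z 1 = z 3 \<longrightarrow> m (i 1) \<ge> 2) \<and>
    (i 2 = i 3 \<and> z 2 = z 3 \<longrightarrow> m (i 2) \<ge> 2) \<and>
    (i 1 = i 2 \<and> z 1 = z 2 \<and> i 1 = i 3 \<and> z 1 = z 3 \<longrightarrow> m (i 1) \<ge> 3)"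
proof -
  have interval: "{1..3::nat} = {1, 2, 3}" by auto
  have card: "card {l\<in>{1..3::nat}. P l} = of_bool (P 1) + of_bool (P 2) + of_bool (P 3)" for P
  proof -
    have "{l\<in>{1..3::nat}. P l} = (if P 1 then {1} else {}) \<union> (if P 2 then {2} else {}) \<union> (if P 3 then {3} else {})"
      unfolding interval by auto
    then show ?thesis by simp
  qed
  have cases: "(of_bool (a = a \<and> x = x) + of_bool (b = a \<and> y = x) + of_bool (c = a \<and> w = x) \<le> m a \<and>
      of_bool (a = b \<and> x = y) + of_bool (b = b \<and> y = y) + of_bool (c = b \<and> w = y) \<le> m b \<and>
      of_bool (a = c \<and> x = w) + of_bool (b = c \<and> y = w) + of_bool (c = c \<and> w = w) \<le> m c) \<longleftrightarrow>
    m a \<ge> 1 \<and> m b \<ge> 1 \<and> m c \<ge> 1 \<and>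
    (a = b \<and> x = y \<longrightarrow> m a \<ge> 2) \<and> (a = c \<and> x = w \<longrightarrow> m a \<ge> 2) \<and>
    (b = c \<and> y = w \<longrightarrow> m b \<ge> 2) \<and>
    (a = b \<and> x = y \<and> a = c \<and> x = w \<longrightarrow> m a \<ge> 3)" for a b c :: nat and x y w :: complex
    by (cases "a = b \<and> x = y"; cases "a = c \<and> x = w"; cases "b = c \<and> y = w") auto
  have "(\<forall>j\<in>{1..3}. card {l\<in>{1..3}. i l = i j \<and> z l = z j} \<le> m (i j)) \<longleftrightarrow>
      (\<forall>j\<in>{1, 2, 3}. of_bool (i 1 = i j \<and> z 1 = z j) + of_bool (i 2 = i j \<and> z 2 = z j) +
        of_bool (i 3 = i j \<and> z 3 = z j) \<le> m (i j))"
    unfolding card unfolding interval ..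
  then show ?thesis using cases[of "i 1" "z 1" "i 2" "z 2" "i 3" "z 3"] by (simp only: ball_simps simp_thms)
qed

theorem theorem2p9:
  fixes act :: "laurent \<Rightarrow> 'a::ab_group_add \<Rightarrow> 'a"
    and b :: "'a \<Rightarrow> 'a \<Rightarrow> fract_mod_laurent"
    and q :: nat and \<eta> :: "nat \<Rightarrow> 'a" and d :: "nat \<Rightarrow> nat"
    and a :: "nat \<Rightarrow> laurent" and \<delta> :: "nat \<Rightarrow> rat poly" and m :: "nat \<Rightarrow> nat"
    and i :: "nat \<Rightarrow> nat"
  assumes "blanchfield_module act b"
    and "blanchfield_decomposition act b q \<eta> d a \<delta> m"
    and "\<forall>j\<in>{1..3}. i j \<in> {1..q}"
  shows "H_subspace act \<eta> (i 1) (i 2) (i 3) \<noteq> {\<one>\<^bsub>H_space act\<^esub>} \<longleftrightarrow>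
    (\<exists>z :: nat \<Rightarrow> complex.
       (\<forall>j\<in>{1..3}. poly (map_poly of_rat (\<delta> (i j))) (z j) = 0) \<and>
       z 1 * z 2 * z 3 = 1 \<and>
       (\<forall>j\<in>{1..3}. card {l\<in>{1..3}. i l = i j \<and> z l = z j} \<le> m (i j)))"
proof -
  have mod: "module act" using assms(1) unfolding blanchfield_module_def by (rule conjunct1)
  note D = assms(2)[unfolded blanchfield_decomposition_def]
  have dec: "cyclic_decomposition act q \<eta> (\<lambda>i. laurent_of_poly (\<delta> i))"
    unfolding cyclic_decomposition_def using D by (elim conjE) (intro conjI)
  have prime: "\<exists>\<pi>. prime_elem \<pi> \<and> \<delta> l = \<pi> ^ m l" if "l \<in> {1..q}" for l
    using D that by (elim conjE) (rule bspec)
  have i: "i 1 \<in> {1..q}" "i 2 \<in> {1..q}" "i 3 \<in> {1..q}" using assms(3) by simp_all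
  have ann: "act (laurent_of_poly (\<delta> l)) (\<eta> l) = 0" if "l \<in> {1..q}" for l
    using conjunct2[OF dec[unfolded cyclic_decomposition_def]] that by simp
  have interval: "{1..3::nat} = {1, 2, 3}" by auto
  have pos: "m l \<ge> 1" if "l \<in> {1..q}" "poly (map_poly of_rat (\<delta> l)) (z :: complex) = 0" for l z
  proof (rule ccontr)
    assume "\<not> m l \<ge> 1"
    then have "m l = 0" by simp
    then have "\<delta> l = 1" using prime[OF that(1)] by auto
    then show False using that(2) by simp
  qed
  show ?thesis
    unfolding H_subspace_nontrivial_iff_form card_le_iff_distinct_pairs
  proof
    assume "\<exists>F k1 k2 k3. invariant_form act F \<and>
      F (act (Poly_Mapping.single k1 1) (\<eta> (i 1))) (act (Poly_Mapping.single k2 1) (\<eta> (i 2)))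
        (act (Poly_Mapping.single k3 1) (\<eta> (i 3))) \<noteq> 0"
    then obtain F k1 k2 k3 where F: "invariant_form act F"
      "F (act (Poly_Mapping.single k1 1) (\<eta> (i 1))) (act (Poly_Mapping.single k2 1) (\<eta> (i 2)))
        (act (Poly_Mapping.single k3 1) (\<eta> (i 3))) \<noteq> 0" by blast
    obtain z1 z2 z3 :: complex where z: "poly (map_poly of_rat (\<delta> (i 1))) z1 = 0"
      "poly (map_poly of_rat (\<delta> (i 2))) z2 = 0" "poly (map_poly of_rat (\<delta> (i 3))) z3 = 0" "z1 * z2 * z3 = 1"
      "i 1 = i 2 \<and> z1 = z2 \<longrightarrow> m (i 1) \<ge> 2" "i 1 = i 3 \<and> z1 = z3 \<longrightarrow> m (i 1) \<ge> 2"
      "i 2 = i 3 \<and> z2 = z3 \<longrightarrow> m (i 2) \<ge> 2"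
      "i 1 = i 2 \<and> z1 = z2 \<and> i 1 = i 3 \<and> z1 = z3 \<longrightarrow> m (i 1) \<ge> 3"
    proof (rule roots_from_form[where ?i1.0 = "i 1" and ?i2.0 = "i 2" and ?i3.0 = "i 3" and \<delta> = \<delta>
        and m = m and \<eta> = \<eta> and F = F and ?k1.0 = k1 and ?k2.0 = k2 and ?k3.0 = k3, OF mod _ _ F])
      show "act (laurent_of_poly (\<delta> l)) (\<eta> l) = 0" if "l \<in> {i 1, i 2, i 3}" for l
        using that i by (intro ann) auto
      show "\<exists>\<pi>. prime_elem \<pi> \<and> \<delta> l = \<pi> ^ m l" if "l \<in> {i 1, i 2, i 3}" for l
        using that i by (intro prime) auto
    qed (rule that)
    define z where "z = (\<lambda>j::nat. if j = 1 then z1 else if j = 2 then z2 else z3)"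
    have zs: "z 1 = z1" "z 2 = z2" "z 3 = z3" by (simp_all add: z_def)
    show "\<exists>z :: nat \<Rightarrow> complex. (\<forall>j\<in>{1..3}. poly (map_poly of_rat (\<delta> (i j))) (z j) = 0) \<and>
       z 1 * z 2 * z 3 = 1 \<and> m (i 1) \<ge> 1 \<and> m (i 2) \<ge> 1 \<and> m (i 3) \<ge> 1 \<and>
       (i 1 = i 2 \<and> z 1 = z 2 \<longrightarrow> m (i 1) \<ge> 2) \<and> (i 1 = i 3 \<and> z 1 = z 3 \<longrightarrow> m (i 1) \<ge> 2) \<and>
       (i 2 = i 3 \<and> z 2 = z 3 \<longrightarrow> m (i 2) \<ge> 2) \<and>
       (i 1 = i 2 \<and> z 1 = z 2 \<and> i 1 = i 3 \<and> z 1 = z 3 \<longrightarrow> m (i 1) \<ge> 3)"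
      using z pos[OF i(1) z(1)] pos[OF i(2) z(2)] pos[OF i(3) z(3)]
      by (intro exI[of _ z]) (simp only: zs interval ball_simps simp_thms)
  next
    assume "\<exists>z :: nat \<Rightarrow> complex. (\<forall>j\<in>{1..3}. poly (map_poly of_rat (\<delta> (i j))) (z j) = 0) \<and>
       z 1 * z 2 * z 3 = 1 \<and> m (i 1) \<ge> 1 \<and> m (i 2) \<ge> 1 \<and> m (i 3) \<ge> 1 \<and>
       (i 1 = i 2 \<and> z 1 = z 2 \<longrightarrow> m (i 1) \<ge> 2) \<and> (i 1 = i 3 \<and> z 1 = z 3 \<longrightarrow> m (i 1) \<ge> 2) \<and>
       (i 2 = i 3 \<and> z 2 = z 3 \<longrightarrow> m (i 2) \<ge> 2) \<and>
       (i 1 = i 2 \<and> z 1 = z 2 \<and> i 1 = i 3 \<and> z 1 = z 3 \<longrightarrow> m (i 1) \<ge> 3)"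
    then obtain z :: "nat \<Rightarrow> complex" where root: "\<forall>j\<in>{1..3}. poly (map_poly of_rat (\<delta> (i j))) (z j) = 0"
      and prod: "z 1 * z 2 * z 3 = 1"
      and m: "m (i 1) \<ge> 1" "m (i 2) \<ge> 1" "m (i 3) \<ge> 1"
       "i 1 = i 2 \<and> z 1 = z 2 \<longrightarrow> m (i 1) \<ge> 2" "i 1 = i 3 \<and> z 1 = z 3 \<longrightarrow> m (i 1) \<ge> 2"
       "i 2 = i 3 \<and> z 2 = z 3 \<longrightarrow> m (i 2) \<ge> 2"
       "i 1 = i 2 \<and> z 1 = z 2 \<and> i 1 = i 3 \<and> z 1 = z 3 \<longrightarrow> m (i 1) \<ge> 3"
      by (elim exE conjE) (rule that)
    have dvd: "[:- z j, 1:] ^ m (i j) dvd map_poly of_rat (\<delta> (i j))" if j: "j \<in> {1..3}" for j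
    proof -
      obtain \<pi> where \<pi>: "prime_elem \<pi>" "\<delta> (i j) = \<pi> ^ m (i j)"
        using prime[OF bspec[OF assms(3) j]] by blast
      have "poly (map_poly of_rat (\<pi> ^ m (i j))) (z j) = 0"
        using bspec[OF root j] unfolding \<pi>(2)[symmetric] .
      then obtain e where "map_poly of_rat (\<pi> ^ m (i j)) = [:- z j, 1:] ^ m (i j) * e"
        using prime_power_root_multiplicity[OF \<pi>(1)] by blast
      then show ?thesis unfolding \<pi>(2)[symmetric] by (rule dvdI)
    qed
    have "[:- z 1, 1:] ^ m (i 1) dvd map_poly of_rat (\<delta> (i 1))" 
      "[:- z 2, 1:] ^ m (i 2) dvd map_poly of_rat (\<delta> (i 2))"
      "[:- z 3, 1:] ^ m (i 3) dvd map_poly of_rat (\<delta> (i 3))" by (rule dvd, simp)+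
    then show "\<exists>F k1 k2 k3. invariant_form act F \<and>
      F (act (Poly_Mapping.single k1 1) (\<eta> (i 1))) (act (Poly_Mapping.single k2 1) (\<eta> (i 2)))
        (act (Poly_Mapping.single k3 1) (\<eta> (i 3))) \<noteq> 0"
      by (rule form_from_roots[OF mod dec i _ _ _ prod m])
  qed
qed

end
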